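(* Let $W$ be a subset of $\mathbf{Gr}_{S_m}^{q}$. Then $\mathbf{gin}(W)$ belongs to $\mathbf B_{S_m}^{q}$.
   Context: $K$ is an infinite field, $S=K[x_0,\dots,x_n]$ with the standard grading, $S_m$ is its degree $m$ component, a term is a monic monomial, $\prec$ is a term order on $S$ with $x_0\prec\dots\prec x_n$, $m,q$ are positive integers. $\mathbf{Gr}_{S_m}^{q}$ is the Grassmannian scheme over $K$ of $q$-dimensional subspaces of $S_m$, embedded in $\mathbb P(\wedge^qS_m)$ by Plücker. "Subset" means non-empty set of (not necessarily closed) points of the scheme. $\mathbf T_{S_m}^{q}$ is the set of $\tau_1\wedge\dots\wedge\tau_q$ with $\tau_i$ terms in $S_m$, $\tau_1\succ\dots\succ\tau_q$, totally ordered by: $\tau_1\wedge\dots\wedge\tau_q\prec\sigma_1\wedge\dots\wedge\sigma_q$ iff for some $j$, $\tau_i=\sigma_i$ for $i<j$ and $\tau_j\prec\sigma_j$. For $L\in\mathbf T_{S_m}^{q}$, $U_L\subseteq\mathbf{Gr}_{S_m}^{q}$ is the open set where the Plücker coordinate $\Delta_L$ is invertible. $\mathrm{GL}=\mathrm{GL}_K(n+1)$ acts on $S$ by $g(f)=f(\sum_j g_{0j}x_j,\dots,\sum_j g_{nj}x_j)$ and correspondingly on $\wedge^qS_m$ and, by automorphisms, on $\mathbf{Gr}_{S_m}^{q}$; $\mathcal O(W)=\{g(V):V\in W,\ g\in\mathrm{GL}\}$. The generic initial extensor is $\mathbf{gin}(W)=\max_\prec\{L\in\mathbf T_{S_m}^{q}:U_L\cap\mathcal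 O(W)\ne\emptyset\}$. A term $L\in\mathbf T_{S_m}^{q}$ is Borel if $g(L)\in\langle L\rangle$ for every upper-triangular matrix $g\in\mathrm{GL}$; $\mathbf B_{S_m}^{q}$ is the set of Borel terms. *)

theory Defs
  imports
    "HOL-Library.Poly_Mapping"
    "HOL-Algebra.Ideal"
    "Jordan_Normal_Form.Determinant"
begin

text \<open>
  Multivariate polynomials over \<open>'k\<close> with variables in \<open>'v\<close> are elements of the convolution ring
  \<open>('v \<Rightarrow>\<^sub>0 nat) \<Rightarrow>\<^sub>0 'k\<close>; a term (monic monomial) is its exponent vector of type \<open>'v \<Rightarrow>\<^sub>0 nat\<close>, so that
  multiplication of terms is addition of exponent vectors and the term \<open>1\<close> is \<open>0\<close>.
\<close>

definition pvar :: "'v \<Rightarrow> ('v \<Rightarrow>\<^sub>0 nat) \<Rightarrow>\<^sub>0 'k::comm_ring_1"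
  where "pvar v = Poly_Mapping.single (Poly_Mapping.single v 1) 1"

definition pconst :: "'k \<Rightarrow> ('v \<Rightarrow>\<^sub>0 nat) \<Rightarrow>\<^sub>0 'k::comm_ring_1"
  where "pconst c = Poly_Mapping.single 0 c"

definition psubst ::
  "('v \<Rightarrow> ('w \<Rightarrow>\<^sub>0 nat) \<Rightarrow>\<^sub>0 'k) \<Rightarrow> (('v \<Rightarrow>\<^sub>0 nat) \<Rightarrow>\<^sub>0 'k) \<Rightarrow> ('w \<Rightarrow>\<^sub>0 nat) \<Rightarrow>\<^sub>0 'k::comm_ring_1"
  where "psubst s f =
    (\<Sum>a\<in>Poly_Mapping.keys f. pconst (Poly_Mapping.lookup f a) *
      (\<Prod>v\<in>Poly_Mapping.keys a. s v ^ Poly_Mapping.lookup a v))"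

definition tdeg :: "('v \<Rightarrow>\<^sub>0 nat) \<Rightarrow> nat"
  where "tdeg a = (\<Sum>v\<in>Poly_Mapping.keys a. Poly_Mapping.lookup a v)"

definition hom_component :: "nat \<Rightarrow> (('v \<Rightarrow>\<^sub>0 nat) \<Rightarrow>\<^sub>0 'k) \<Rightarrow> ('v \<Rightarrow>\<^sub>0 nat) \<Rightarrow>\<^sub>0 'k::comm_ring_1"
  where "hom_component d f =
    (\<Sum>a\<in>{a \<in> Poly_Mapping.keys f. tdeg a = d}. Poly_Mapping.single a (Poly_Mapping.lookup f a))"


section \<open>Terms and term orders of \<open>S = K[x\<^sub>0, \<dots>, x\<^sub>n]\<close>\<close>

type_synonym trm = "nat \<Rightarrow>\<^sub>0 nat"

definition xterm :: "nat \<Rightarrow> trm"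
  where "xterm i = Poly_Mapping.single i 1"

definition terms_S :: "nat \<Rightarrow> trm set"
  where "terms_S n = {t. Poly_Mapping.keys t \<subseteq> {..n}}"

definition terms_deg :: "nat \<Rightarrow> nat \<Rightarrow> trm set"
  where "terms_deg n m = {t \<in> terms_S n. tdeg t = m}"

text \<open>\<open>lt\<close> is the strict relation \<open>\<prec>\<close>.\<close>

definition term_order :: "nat \<Rightarrow> (trm \<Rightarrow> trm \<Rightarrow> bool) \<Rightarrow> bool"
  where "term_order n lt \<longleftrightarrow>
    irreflp_on (terms_S n) lt \<and> transp_on (terms_S n) lt \<and> totalp_on (terms_S n) lt \<and>
    (\<forall>t\<in>terms_S n. t \<noteq> 0 \<longrightarrow> lt 0 t) \<and>
    (\<forall>s\<in>terms_S n. \<forall>t\<in>terms_S n. \<forall>u\<in>terms_S n. lt s t \<longrightarrow> lt (s + u) (t + u))"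


section \<open>The terms of the exterior power \<open>\<Lambda>\<^sup>q S\<^sub>m\<close>\<close>

text \<open>The extensor \<open>\<tau>\<^sub>1 \<and> \<dots> \<and> \<tau>\<^sub>q\<close> with \<open>\<tau>\<^sub>1 \<succ> \<dots> \<succ> \<tau>\<^sub>q\<close> is represented by the list of its factors.\<close>

definition ext_terms :: "nat \<Rightarrow> nat \<Rightarrow> nat \<Rightarrow> (trm \<Rightarrow> trm \<Rightarrow> bool) \<Rightarrow> trm list set"
  where "ext_terms n m q lt =
    {L. length L = q \<and> set L \<subseteq> terms_deg n m \<and> sorted_wrt (\<lambda>s t. lt t s) L}"

definition ext_less :: "(trm \<Rightarrow> trm \<Rightarrow> bool) \<Rightarrow> trm list \<Rightarrow> trm list \<Rightarrow> bool"
  where "ext_less lt L M \<longleftrightarrow>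
    (\<exists>j. j < length L \<and> j < length M \<and> (\<forall>i<j. L ! i = M ! i) \<and> lt (L ! j) (M ! j))"

text \<open>
  An element of \<open>\<Lambda>\<^sup>q S\<^sub>m\<close> is represented by its coordinates with respect to the basis
  \<open>ext_terms n m q lt\<close>. The coordinate of \<open>f\<^sub>1 \<and> \<dots> \<and> f\<^sub>q\<close> at \<open>\<sigma>\<^sub>1 \<and> \<dots> \<and> \<sigma>\<^sub>q\<close> is the minor
  \<open>det (coefficient of \<sigma>\<^sub>j in f\<^sub>i)\<close>.
\<close>

definition wedge :: "nat \<Rightarrow> nat \<Rightarrow> nat \<Rightarrow> (trm \<Rightarrow> trm \<Rightarrow> bool) \<Rightarrow>
    (trm \<Rightarrow>\<^sub>0 'k) list \<Rightarrow> trm list \<Rightarrow>\<^sub>0 'k::comm_ring_1"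
  where "wedge n m q lt fs =
    (\<Sum>M\<in>ext_terms n m q lt. Poly_Mapping.single M
      (det (mat q q (\<lambda>(i, j). Poly_Mapping.lookup (fs ! i) (M ! j)))))"


section \<open>The action of \<open>GL\<^sub>K(n+1)\<close>\<close>

definition GL_mat :: "nat \<Rightarrow> 'k::comm_ring_1 mat set"
  where "GL_mat n = {g \<in> carrier_mat (n + 1) (n + 1). invertible_mat g}"

definition act_S :: "nat \<Rightarrow> 'k::comm_ring_1 mat \<Rightarrow> (trm \<Rightarrow>\<^sub>0 'k) \<Rightarrow> trm \<Rightarrow>\<^sub>0 'k"
  where "act_S n g f = psubst (\<lambda>i. \<Sum>j\<le>n. pconst (g $$ (i, j)) * pvar j) f"

definition act_ext :: "nat \<Rightarrow> nat \<Rightarrow> nat \<Rightarrow> (trm \<Rightarrow> trm \<Rightarrow> bool) \<Rightarrow> 'k::comm_ring_1 mat \<Rightarrow>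
    (trm list \<Rightarrow>\<^sub>0 'k) \<Rightarrow> trm list \<Rightarrow>\<^sub>0 'k"
  where "act_ext n m q lt g v =
    (\<Sum>L\<in>Poly_Mapping.keys v.
      Poly_Mapping.map ((*) (Poly_Mapping.lookup v L))
        (wedge n m q lt (map (\<lambda>t. act_S n g (Poly_Mapping.single t 1)) L)))"


section \<open>The points of the Grassmannian scheme\<close>

text \<open>
  \<open>Gr\<close> is the closed subscheme of \<open>P(\<Lambda>\<^sup>q S\<^sub>m) = Proj K[\<Delta>\<^sub>L]\<close> defined by the Pluecker relations, so its
  points are the homogeneous prime ideals of \<open>K[\<Delta>\<^sub>L]\<close> that contain these relations and do not
  contain all \<open>\<Delta>\<^sub>L\<close>. Here the \<open>\<Delta>\<^sub>L\<close> are the coordinate functions of a vector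
  \<open>\<Sum>\<^sub>L \<Delta>\<^sub>L L\<close> of \<open>\<Lambda>\<^sup>q S\<^sub>m\<close>.
\<close>

type_synonym 'k plpoly = "(trm list \<Rightarrow>\<^sub>0 nat) \<Rightarrow>\<^sub>0 'k"

definition plucker_ring :: "nat \<Rightarrow> nat \<Rightarrow> nat \<Rightarrow> (trm \<Rightarrow> trm \<Rightarrow> bool) \<Rightarrow> 'k::comm_ring_1 plpoly ring"
  where "plucker_ring n m q lt =
    \<lparr>carrier = {f. \<forall>a\<in>Poly_Mapping.keys f. Poly_Mapping.keys a \<subseteq> ext_terms n m q lt},
     monoid.mult = (*), one = 1, zero = 0, add = (+)\<rparr>"

text \<open>
  The coordinate \<open>\<Delta>\<close> extended to arbitrary lists of \<open>q\<close> terms of \<open>S\<^sub>m\<close> as an alternating function;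
  the sign is that of the permutation sorting the list in descending order.
\<close>

definition plucker_alt :: "nat \<Rightarrow> nat \<Rightarrow> nat \<Rightarrow> (trm \<Rightarrow> trm \<Rightarrow> bool) \<Rightarrow> trm list \<Rightarrow> 'k::comm_ring_1 plpoly"
  where "plucker_alt n m q lt ts =
    (if distinct ts
     then (-1) ^ card {(i, j). i < j \<and> j < length ts \<and> lt (ts ! i) (ts ! j)} *
          pvar (THE L. L \<in> ext_terms n m q lt \<and> set L = set ts)
     else 0)"

definition plucker_relations :: "nat \<Rightarrow> nat \<Rightarrow> nat \<Rightarrow> (trm \<Rightarrow> trm \<Rightarrow> bool) \<Rightarrow> 'k::comm_ring_1 plpoly set"
  where "plucker_relations n m q lt =
    {(\<Sum>k\<le>q. (-1) ^ k * plucker_alt n m q lt (I @ [J ! k])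
                  * plucker_alt n m q lt (take k J @ drop (Suc k) J)) | I J.
      set I \<subseteq> terms_deg n m \<and> set J \<subseteq> terms_deg n m \<and> length I + 1 = q \<and> length J = q + 1}"

definition Gr_points :: "nat \<Rightarrow> nat \<Rightarrow> nat \<Rightarrow> (trm \<Rightarrow> trm \<Rightarrow> bool) \<Rightarrow> 'k::comm_ring_1 plpoly set set"
  where "Gr_points n m q lt =
    {P. primeideal P (plucker_ring n m q lt) \<and>
        (\<forall>f\<in>P. \<forall>d. hom_component d f \<in> P) \<and>
        plucker_relations n m q lt \<subseteq> P \<and>
        (\<exists>L\<in>ext_terms n m q lt. pvar L \<notin> P)}"

definition Gr_chart :: "nat \<Rightarrow> nat \<Rightarrow> nat \<Rightarrow> (trm \<Rightarrow> trm \<Rightarrow> bool) \<Rightarrow> trm list \<Rightarrow> 'k::comm_ring_1 plpoly set set"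
  where "Gr_chart n m q lt L = {P \<in> Gr_points n m q lt. pvar L \<notin> P}"

text \<open>
  The linear automorphism \<open>g\<close> of \<open>\<Lambda>\<^sup>q S\<^sub>m\<close> pulls back \<open>\<Delta>\<^sub>M\<close> to \<open>\<Sum>\<^sub>L c\<^sub>M\<^sub>L \<Delta>\<^sub>L\<close>, where \<open>c\<^sub>M\<^sub>L\<close> is the
  coordinate of \<open>g(L)\<close> at \<open>M\<close>. The image of a point \<open>P\<close> under the induced automorphism of the scheme is
  the preimage of \<open>P\<close> under this ring map; for the point given by a line \<open>\<langle>v\<rangle>\<close> (\<open>P\<close> generated by the forms
  vanishing at \<open>v\<close>) this is the point given by \<open>\<langle>g(v)\<rangle>\<close>.
\<close>

definition plucker_pullback :: "nat \<Rightarrow> nat \<Rightarrow> nat \<Rightarrow> (trm \<Rightarrow> trm \<Rightarrow> bool) \<Rightarrow> 'k::comm_ring_1 mat \<Rightarrow>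
    'k plpoly \<Rightarrow> 'k plpoly"
  where "plucker_pullback n m q lt g =
    psubst (\<lambda>M. \<Sum>L\<in>ext_terms n m q lt.
      pconst (Poly_Mapping.lookup (act_ext n m q lt g (Poly_Mapping.single L 1)) M) * pvar L)"

definition act_Gr :: "nat \<Rightarrow> nat \<Rightarrow> nat \<Rightarrow> (trm \<Rightarrow> trm \<Rightarrow> bool) \<Rightarrow> 'k::comm_ring_1 mat \<Rightarrow>
    'k plpoly set \<Rightarrow> 'k plpoly set"
  where "act_Gr n m q lt g P =
    {f \<in> carrier (plucker_ring n m q lt). plucker_pullback n m q lt g f \<in> P}"

definition orbit_Gr :: "nat \<Rightarrow> nat \<Rightarrow> nat \<Rightarrow> (trm \<Rightarrow> trm \<Rightarrow> bool) \<Rightarrow>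
    'k::comm_ring_1 plpoly set set \<Rightarrow> 'k plpoly set set"
  where "orbit_Gr n m q lt W = {act_Gr n m q lt g V | g V. V \<in> W \<and> g \<in> GL_mat n}"


section \<open>Generic initial extensor and Borel terms\<close>

definition gin :: "nat \<Rightarrow> nat \<Rightarrow> nat \<Rightarrow> (trm \<Rightarrow> trm \<Rightarrow> bool) \<Rightarrow>
    'k::comm_ring_1 plpoly set set \<Rightarrow> trm list"
  where "gin n m q lt W =
    (let A = {L \<in> ext_terms n m q lt. Gr_chart n m q lt L \<inter> orbit_Gr n m q lt W \<noteq> {}}
     in THE L. L \<in> A \<and> (\<forall>M\<in>A. M = L \<or> ext_less lt M L))"

definition borel_ext_terms :: "'k::comm_ring_1 itself \<Rightarrow>
    nat \<Rightarrow> nat \<Rightarrow> nat \<Rightarrow> (trm \<Rightarrow> trm \<Rightarrow> bool) \<Rightarrow> trm list set"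
  where "borel_ext_terms _ n m q lt =
    {L \<in> ext_terms n m q lt.
      \<forall>g::'k mat. g \<in> GL_mat n \<longrightarrow> upper_triangular g \<longrightarrow>
        (\<exists>c. act_ext n m q lt g (Poly_Mapping.single L 1) = Poly_Mapping.single L c)}"

end

theory Submission
  imports Defs "HOL-Algebra.QuotRing"
begin

text \<open>
  Let \<open>L = gin(W)\<close> and let \<open>Q\<close> be a point of the orbit with \<open>\<Delta>\<^sub>L \<notin> Q\<close>; then \<open>L\<close> is the largest term whose
  coordinate does not vanish at \<open>Q\<close>. A Pluecker exchange relation shows that every other \<open>L'\<close> with
  \<open>\<Delta>\<^sub>L\<^sub>' \<notin> Q\<close> has a strictly smaller weight \<open>\<Prod>\<tau>\<^sub>i\<close>. This is where decomposability enters: in characteristic 0 the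
  \<open>SL\<^sub>2\<close>-invariant vectors of \<open>\<Lambda>\<^sup>2 S\<^sub>3\<close> for \<open>n = 1\<close> have the leading term \<open>x\<^sub>1\<^sup>3 \<and> x\<^sub>0\<^sup>3\<close>, which is not Borel.

  Let \<open>u\<close> be upper triangular and let \<open>d\<close> be diagonal. If \<open>M \<succ> L\<close>, then \<open>\<Delta>\<^sub>M\<close> vanishes at the translate of
  \<open>Q\<close> by \<open>d\<close> followed by \<open>u\<close>, which means \<open>\<Sum>\<^sub>N c\<^sub>M\<^sub>N \<chi>\<^sub>N(d) \<Delta>\<^sub>N \<in> Q\<close>, where \<open>c\<^sub>M\<^sub>N\<close> is the coordinate of \<open>u(N)\<close> at \<open>M\<close>
  and \<open>\<chi>\<^sub>N\<close> is the character of the torus given by the weight of \<open>N\<close>. Distinct weights give independent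
  characters because \<open>K\<close> is infinite, so the part of the weight of \<open>L\<close> lies in \<open>Q\<close>; modulo \<open>Q\<close> this part is
  \<open>c\<^sub>M\<^sub>L \<Delta>\<^sub>L\<close>, hence \<open>c\<^sub>M\<^sub>L = 0\<close>. For \<open>M \<prec> L\<close> the coordinate \<open>c\<^sub>M\<^sub>L\<close> vanishes by triangularity.
\<close>

section \<open>Substitution\<close>

definition pmon :: "('v \<Rightarrow> ('w \<Rightarrow>\<^sub>0 nat) \<Rightarrow>\<^sub>0 'k) \<Rightarrow> ('v \<Rightarrow>\<^sub>0 nat) \<Rightarrow> ('w \<Rightarrow>\<^sub>0 nat) \<Rightarrow>\<^sub>0 'k::comm_ring_1"
  where "pmon s a = (\<Prod>v\<in>Poly_Mapping.keys a. s v ^ Poly_Mapping.lookup a v)"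

lemma pmon_superset:
  assumes "finite A" "Poly_Mapping.keys a \<subseteq> A"
  shows "pmon s a = (\<Prod>v\<in>A. s v ^ Poly_Mapping.lookup a v)"
  unfolding pmon_def
  by (rule prod.mono_neutral_left) (use assms in \<open>auto simp: in_keys_iff\<close>)

lemma pmon_zero [simp]: "pmon s 0 = 1"
  by (simp add: pmon_def)

lemma pmon_add: "pmon s (a + b) = pmon s a * pmon s b"
proof -
  let ?A = "Poly_Mapping.keys a \<union> Poly_Mapping.keys b"
  have "pmon s (a + b) = (\<Prod>v\<in>?A. s v ^ Poly_Mapping.lookup (a + b) v)"
    by (rule pmon_superset) (auto simp: in_keys_iff lookup_add)
  also have "\<dots> = (\<Prod>v\<in>?A. s v ^ Poly_Mapping.lookup a v) * (\<Prod>v\<in>?A. s v ^ Poly_Mapping.lookup b v)"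
    by (simp add: lookup_add power_add prod.distrib)
  also have "\<dots> = pmon s a * pmon s b"
    by (simp add: pmon_superset[symmetric])
  finally show ?thesis .
qed

lemma pmon_single: "pmon s (Poly_Mapping.single v k) = s v ^ k"
  by (cases "k = 0") (simp_all add: pmon_def)

lemma pmon_cong:
  assumes "\<And>v. v \<in> Poly_Mapping.keys a \<Longrightarrow> s v = r v"
  shows "pmon s a = pmon r a"
  unfolding pmon_def using assms by (auto intro: prod.cong)

lemma pconst_simps [simp]: "pconst 0 = 0" "pconst 1 = 1"
  by (simp_all add: pconst_def)

lemma pconst_add: "pconst (c + d) = pconst c + pconst d"
  by (simp add: pconst_def single_add)

lemma pconst_mult: "pconst (c * d) = pconst c * pconst d"
  by (simp add: pconst_def mult_single)

lemma pconst_sum: "pconst (sum f A) = (\<Sum>a\<in>A. pconst (f a))"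
  by (induction A rule: infinite_finite_induct) (simp_all add: pconst_add)

lemma pconst_prod: "pconst (prod f A) = (\<Prod>a\<in>A. pconst (f a))"
  by (induction A rule: infinite_finite_induct) (simp_all add: pconst_mult)

lemma pconst_power: "pconst (c ^ k) = pconst c ^ k"
  by (induction k) (simp_all add: pconst_mult)

lemma pconst_uminus: "pconst (- c) = - pconst c"
  by (simp add: pconst_def single_uminus)

lemma pconst_mult_single: "pconst c * Poly_Mapping.single a d = Poly_Mapping.single a (c * d)"
  by (simp add: pconst_def mult_single)

lemma lookup_pconst_mult:
  "Poly_Mapping.lookup (pconst c * f) a = c * Poly_Mapping.lookup f a"
  unfolding pconst_def mult_map_scale_conv_mult[symmetric]
  by (simp add: Poly_Mapping.map.rep_eq when_def)

lemma poly_mapping_sum_single: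
  fixes f :: "'a \<Rightarrow>\<^sub>0 'b::comm_monoid_add"
  shows "f = (\<Sum>a\<in>Poly_Mapping.keys f. Poly_Mapping.single a (Poly_Mapping.lookup f a))"
  by (rule poly_mapping_eqI) (auto simp: lookup_sum lookup_single when_def in_keys_iff)

text \<open>This serves for polynomials and for exponent vectors alike. The added entry may be zero
  or sit at a key already present.\<close>

lemma poly_mapping_add_induct [case_names zero add]:
  fixes f :: "'a \<Rightarrow>\<^sub>0 'b::comm_monoid_add"
  assumes "P 0" and "\<And>f a c. P f \<Longrightarrow> P (f + Poly_Mapping.single a c)"
  shows "P f"
proof -
  have "P (\<Sum>a\<in>A. Poly_Mapping.single a (Poly_Mapping.lookup f a))" if "finite A" for A
    using that
  proof (induction A rule: finite_induct)
    case (insert x F)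
    then show ?case
      using assms(2)[OF insert.IH, of x "Poly_Mapping.lookup f x"] by (simp add: add.commute)
  qed (simp add: assms(1))
  then show ?thesis
    by (subst poly_mapping_sum_single) simp
qed

lemma psubst_superset:
  assumes "finite A" "Poly_Mapping.keys f \<subseteq> A"
  shows "psubst s f = (\<Sum>a\<in>A. pconst (Poly_Mapping.lookup f a) * pmon s a)"
  unfolding psubst_def pmon_def[symmetric]
  by (rule sum.mono_neutral_left) (use assms in \<open>auto simp: in_keys_iff\<close>)

lemma psubst_single: "psubst s (Poly_Mapping.single a c) = pconst c * pmon s a"
  by (subst psubst_superset[of "{a}"]) auto

lemma psubst_zero [simp]: "psubst s 0 = 0"
  by (simp add: psubst_def)

lemma psubst_add: "psubst s (f + g) = psubst s f + psubst s g"
proof -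
  let ?A = "Poly_Mapping.keys f \<union> Poly_Mapping.keys g"
  show ?thesis
    by (subst (1 2 3) psubst_superset[of ?A])
      (auto simp: in_keys_iff lookup_add pconst_add distrib_right sum.distrib)
qed

lemma psubst_sum: "psubst s (sum f A) = (\<Sum>a\<in>A. psubst s (f a))"
  by (induction A rule: infinite_finite_induct) (simp_all add: psubst_add)

text \<open>Both sides are additive in \<open>f\<close> and in \<open>g\<close>, so the claim
  reduces to two monomials, where it is \<open>pmon_add\<close>.\<close>

lemma psubst_mult: "psubst s (f * g) = psubst s f * psubst s g"
proof (induction f rule: poly_mapping_add_induct)
  case zero
  show ?case by simp
next
  case (add f a c)
  have "psubst s (Poly_Mapping.single a c * g) = psubst s (Poly_Mapping.single a c) * psubst s g"
  proof (induction g rule: poly_mapping_add_induct)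
    case (add g b d)
    then show ?case
      by (simp add: distrib_left psubst_add mult_single psubst_single pmon_add pconst_mult mult_ac)
  qed simp
  with add show ?case
    by (simp add: distrib_right psubst_add)
qed

lemma psubst_pconst [simp]: "psubst s (pconst c) = pconst c"
  using psubst_single[of s 0 c] by (simp add: pconst_def)

lemma psubst_one [simp]: "psubst s 1 = 1"
  using psubst_pconst[of s 1] by simp

lemma psubst_pvar [simp]: "psubst s (pvar v) = s v"
  by (simp add: pvar_def psubst_single pmon_single)

lemma psubst_uminus: "psubst s (- f) = - psubst s f"
  using psubst_add[of s f "- f"] by (simp add: eq_neg_iff_add_eq_0 add.commute)

lemma psubst_power: "psubst s (f ^ k) = psubst s f ^ k"
  by (induction k) (simp_all add: psubst_mult)

lemma psubst_prod: "psubst s (prod f A) = (\<Prod>a\<in>A. psubst s (f a))"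
  by (induction A rule: infinite_finite_induct) (simp_all add: psubst_mult)

lemma psubst_cong:
  assumes "\<And>a v. a \<in> Poly_Mapping.keys f \<Longrightarrow> v \<in> Poly_Mapping.keys a \<Longrightarrow> s v = r v"
  shows "psubst s f = psubst r f"
  unfolding psubst_def using assms by (intro sum.cong refl arg_cong2[of _ _ _ _ "(*)"] prod.cong) auto

lemma psubst_psubst: "psubst s (psubst r f) = psubst (\<lambda>v. psubst s (r v)) f"
  unfolding psubst_def[of r] psubst_def[of "\<lambda>v. psubst s (r v)"]
  by (simp add: psubst_sum psubst_mult psubst_prod psubst_power)

lemma pmon_pvar: "pmon pvar a = Poly_Mapping.single a (1::'k::comm_ring_1)"
proof (induction a rule: poly_mapping_add_induct)
  case (add f a c)
  have "(pvar a :: _ \<Rightarrow>\<^sub>0 'k) ^ k = Poly_Mapping.single (Poly_Mapping.single a k) 1" for k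
    by (induction k) (simp_all add: pvar_def mult_single single_add[symmetric])
  with add show ?case
    by (simp add: pmon_add pmon_single mult_single)
qed simp

lemma keys_mult_elim:
  assumes "c \<in> Poly_Mapping.keys (f * g)"
  obtains a b where "a \<in> Poly_Mapping.keys f" "b \<in> Poly_Mapping.keys g" "c = a + b"
  using keys_mult[of f g] assms by auto

section \<open>Degrees and homogeneous components\<close>

lemma tdeg_superset:
  assumes "finite A" "Poly_Mapping.keys a \<subseteq> A"
  shows "tdeg a = (\<Sum>v\<in>A. Poly_Mapping.lookup a v)"
  unfolding tdeg_def by (rule sum.mono_neutral_left) (use assms in \<open>auto simp: in_keys_iff\<close>)

lemma tdeg_add: "tdeg (a + b) = tdeg a + tdeg b"
proof -
  let ?A = "Poly_Mapping.keys a \<union> Poly_Mapping.keys b"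
  show ?thesis
    by (subst (1 2 3) tdeg_superset[of ?A]) (auto simp: in_keys_iff lookup_add sum.distrib)
qed

lemma tdeg_zero [simp]: "tdeg 0 = 0"
  by (simp add: tdeg_def)

lemma tdeg_single [simp]: "tdeg (Poly_Mapping.single v k) = k"
  by (simp add: tdeg_def)

lemma lookup_hom_component:
  "Poly_Mapping.lookup (hom_component d f) a = (if tdeg a = d then Poly_Mapping.lookup f a else 0)"
  by (auto simp: hom_component_def lookup_sum lookup_single when_def in_keys_iff)

lemma hom_component_add: "hom_component d (f + g) = hom_component d f + hom_component d g"
  by (rule poly_mapping_eqI) (simp add: lookup_hom_component lookup_add)

lemma hom_component_zero [simp]: "hom_component d 0 = 0"
  by (rule poly_mapping_eqI) (simp add: lookup_hom_component)

lemma hom_component_homogeneous: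
  assumes "\<forall>a\<in>Poly_Mapping.keys f. tdeg a = e"
  shows "hom_component d f = (if d = e then f else 0)"
  by (rule poly_mapping_eqI) (use assms in \<open>auto simp: lookup_hom_component in_keys_iff\<close>)

text \<open>A relation between exponents that is compatible with addition only has to be checked on
  the variables. The instances of \<open>R\<close> are preservation of the degree, membership in
  \<open>terms_S n\<close>, and the order estimate for triangular matrices.\<close>

lemma pmon_keys:
  fixes a :: "'v \<Rightarrow>\<^sub>0 nat"
  assumes "R 0 0" and "\<And>a b a' b'. R a b \<Longrightarrow> R a' b' \<Longrightarrow> R (a + a') (b + b')"
    and "\<And>v b. v \<in> V \<Longrightarrow> b \<in> Poly_Mapping.keys (s v) \<Longrightarrow> R (Poly_Mapping.single v 1) b"
    and "Poly_Mapping.keys a \<subseteq> V" and "b \<in> Poly_Mapping.keys (pmon s a)"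
  shows "R a b"
  using assms(4,5)
proof (induction a arbitrary: b rule: poly_mapping_add_induct)
  case zero
  then show ?case using assms(1) by (simp split: if_splits)
next
  case (add f v c)
  \<comment> \<open>The alternative \<open>k = 0\<close> covers the case where the induction adds a
    zero entry at a variable outside \<open>V\<close>.\<close>
  have pow: "R (Poly_Mapping.single v k) b"
    if "b \<in> Poly_Mapping.keys (s v ^ k)" "v \<in> V \<or> k = 0" for b k
    using that
  proof (induction k arbitrary: b)
    case (Suc k)
    from Suc.prems(1) obtain b1 b2 where b: "b1 \<in> Poly_Mapping.keys (s v)"
      "b2 \<in> Poly_Mapping.keys (s v ^ k)" "b = b1 + b2"
      by (auto elim: keys_mult_elim)
    have "R (Poly_Mapping.single v 1 + Poly_Mapping.single v k) (b1 + b2)"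
      using assms(3)[of v b1] Suc b by (intro assms(2)) auto
    then show ?case using b by (simp add: single_add[symmetric])
  qed (simp add: assms(1) split: if_splits)
  from add.prems(2) obtain b1 b2 where b: "b1 \<in> Poly_Mapping.keys (pmon s f)"
    "b2 \<in> Poly_Mapping.keys (s v ^ c)" "b = b1 + b2"
    by (auto elim: keys_mult_elim simp: pmon_add pmon_single)
  have "Poly_Mapping.keys f \<subseteq> V"
    using add.prems(1) by (auto simp: in_keys_iff lookup_add)
  moreover have "v \<in> V \<or> c = 0"
    using add.prems(1) by (auto simp: in_keys_iff lookup_add subset_iff)
  ultimately have "R f b1" "R (Poly_Mapping.single v c) b2"
    using add.IH pow b by auto
  then show ?case using assms(2) b by simp
qed

lemma pmon_homogeneous:
  fixes s :: "'v \<Rightarrow> ('w \<Rightarrow>\<^sub>0 nat) \<Rightarrow>\<^sub>0 'k::comm_ring_1"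
  assumes "\<And>v b. b \<in> Poly_Mapping.keys (s v) \<Longrightarrow> tdeg b = 1"
    and "b \<in> Poly_Mapping.keys (pmon s a)"
  shows "tdeg b = tdeg a"
  by (rule pmon_keys[where R = "\<lambda>a b. tdeg b = tdeg a" and V = UNIV, OF _ _ _ _ assms(2)])
    (simp_all add: tdeg_add assms(1))

lemma keys_pconst_mult: "Poly_Mapping.keys (pconst c * f) \<subseteq> Poly_Mapping.keys f"
  by (auto simp: in_keys_iff lookup_pconst_mult)

text \<open>Substituting forms of degree 1 keeps the degree of each monomial. The group action on
  points thereby keeps the ideals homogeneous.\<close>

lemma hom_component_psubst:
  assumes "\<And>v b. b \<in> Poly_Mapping.keys (s v) \<Longrightarrow> tdeg b = 1"
  shows "hom_component d (psubst s f) = psubst s (hom_component d f)"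
proof (induction f rule: poly_mapping_add_induct)
  case (add f a c)
  have *: "\<forall>b\<in>Poly_Mapping.keys (pconst c * pmon s a). tdeg b = tdeg a"
  proof
    fix b assume "b \<in> Poly_Mapping.keys (pconst c * pmon s a)"
    then have "b \<in> Poly_Mapping.keys (pmon s a)"
      by (rule subsetD[OF keys_pconst_mult])
    then show "tdeg b = tdeg a"
      by (rule pmon_homogeneous[rotated]) (rule assms)
  qed
  have **: "hom_component d (Poly_Mapping.single a c) = (if d = tdeg a then Poly_Mapping.single a c else 0)"
    by (rule hom_component_homogeneous) auto
  show ?case
    unfolding hom_component_add psubst_add add.IH psubst_single hom_component_homogeneous[OF *] **
    by (simp add: psubst_single)
qed simp

section \<open>Ordering of terms and extensors\<close>

lemma set_delete_nth:
  assumes "distinct L" "k < length L"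
  shows "set (take k L @ drop (Suc k) L) = set L - {L ! k}"
proof -
  have L: "L = take k L @ [L ! k] @ drop (Suc k) L"
    using id_take_nth_drop[OF assms(2)] by simp
  have "distinct (take k L @ [L ! k] @ drop (Suc k) L)"
    using assms(1) L by simp
  moreover have "set L = set (take k L) \<union> {L ! k} \<union> set (drop (Suc k) L)"
    by (subst L) (simp del: append_take_drop_id)
  ultimately show ?thesis
    by (auto simp del: append_take_drop_id)
qed

locale extensors =
  fixes n m q :: nat and lt :: "trm \<Rightarrow> trm \<Rightarrow> bool"
  assumes term_order: "term_order n lt"
begin

abbreviation "T \<equiv> terms_deg n m"
abbreviation "E \<equiv> ext_terms n m q lt"

lemma T_subset: "t \<in> T \<Longrightarrow> t \<in> terms_S n"
  by (simp add: terms_deg_def)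

lemma lt_irrefl: "t \<in> terms_S n \<Longrightarrow> \<not> lt t t"
  using term_order by (auto simp: term_order_def irreflp_on_def)

lemma lt_trans:
  "lt s t \<Longrightarrow> lt t u \<Longrightarrow> s \<in> terms_S n \<Longrightarrow> t \<in> terms_S n \<Longrightarrow> u \<in> terms_S n \<Longrightarrow> lt s u"
  using term_order unfolding term_order_def transp_on_def by blast

lemma lt_total: "s \<in> terms_S n \<Longrightarrow> t \<in> terms_S n \<Longrightarrow> s \<noteq> t \<Longrightarrow> lt s t \<or> lt t s"
  using term_order unfolding term_order_def totalp_on_def by blast

lemma lt_asym: "lt s t \<Longrightarrow> s \<in> terms_S n \<Longrightarrow> t \<in> terms_S n \<Longrightarrow> \<not> lt t s"
  using lt_trans lt_irrefl by blast

lemma lt_add: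
  "lt s t \<Longrightarrow> s \<in> terms_S n \<Longrightarrow> t \<in> terms_S n \<Longrightarrow> u \<in> terms_S n \<Longrightarrow> lt (s + u) (t + u)"
  using term_order unfolding term_order_def by blast

lemma terms_S_zero [simp]: "0 \<in> terms_S n"
  by (simp add: terms_S_def)

lemma terms_S_add: "s \<in> terms_S n \<Longrightarrow> t \<in> terms_S n \<Longrightarrow> s + t \<in> terms_S n"
  using keys_add[of s t] by (auto simp: terms_S_def)

lemma terms_S_sum: "(\<And>x. x \<in> X \<Longrightarrow> x \<in> terms_S n) \<Longrightarrow> sum (\<lambda>x. x) X \<in> terms_S n"
  by (induction X rule: infinite_finite_induct) (auto intro: terms_S_add)

lemma finite_T: "finite T"
proof -
  have "finite {f. \<forall>x. (x \<in> {..n} \<longrightarrow> f x \<in> {..m}) \<and> (x \<notin> {..n} \<longrightarrow> f x = (0::nat))}"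
    by (rule finite_set_of_finite_funs) auto
  moreover have "Poly_Mapping.lookup ` T \<subseteq>
      {f. \<forall>x. (x \<in> {..n} \<longrightarrow> f x \<in> {..m}) \<and> (x \<notin> {..n} \<longrightarrow> f x = (0::nat))}"
  proof (clarsimp simp del: not_le)
    fix t x assume t: "t \<in> T"
    then have "Poly_Mapping.keys t \<subseteq> {..n}" "tdeg t = m"
      by (auto simp: terms_deg_def terms_S_def)
    moreover have "Poly_Mapping.lookup t x \<le> tdeg t" for x
      unfolding tdeg_def
      by (cases "x \<in> Poly_Mapping.keys t") (auto intro: member_le_sum simp: in_keys_iff)
    ultimately show "(x \<le> n \<longrightarrow> Poly_Mapping.lookup t x \<le> m) \<and>
        (\<not> x \<le> n \<longrightarrow> Poly_Mapping.lookup t x = 0)"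
      by (auto simp: in_keys_iff)
  qed
  ultimately have "finite (Poly_Mapping.lookup ` T)"
    by (rule rev_finite_subset)
  then show ?thesis
    by (rule finite_imageD) (auto intro!: inj_onI poly_mapping_eqI)
qed

lemma finite_E: "finite E"
  by (rule finite_subset[OF _ finite_lists_length_eq[OF finite_T, of q]]) (auto simp: ext_terms_def)

lemma E_D:
  assumes "L \<in> E"
  shows "length L = q" "set L \<subseteq> T" "\<And>i j. i < j \<Longrightarrow> j < q \<Longrightarrow> lt (L ! j) (L ! i)"
    "\<And>i. i < q \<Longrightarrow> L ! i \<in> T" "\<And>i. i < q \<Longrightarrow> L ! i \<in> terms_S n"
  using assms by (auto simp: ext_terms_def sorted_wrt_iff_nth_less T_subset dest: nth_mem)

lemma E_distinct: "L \<in> E \<Longrightarrow> distinct L"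
  unfolding distinct_conv_nth using E_D lt_irrefl by (metis linorder_neqE_nat)

lemma E_card: "L \<in> E \<Longrightarrow> card (set L) = q"
  by (simp add: distinct_card E_distinct E_D)

text \<open>Take for \<open>z\<close> the entry of \<open>B\<close> at the first difference: earlier
  entries of \<open>A\<close> are shared with \<open>B\<close>, and all later ones lie below
  \<open>z\<close>. This turns the lexicographic comparison of lists into a statement about their
  sets.\<close>

lemma ext_less_witness:
  assumes "A \<in> E" "B \<in> E" "ext_less lt A B"
  obtains z where "z \<in> set B" "z \<notin> set A" "\<And>w. w \<in> set A \<Longrightarrow> w \<notin> set B \<Longrightarrow> lt w z"
proof -
  from assms(3) obtain j where j: "j < q" "\<And>i. i < j \<Longrightarrow> A ! i = B ! i" "lt (A ! j) (B ! j)"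
    using E_D(1)[OF assms(1)] by (auto simp: ext_less_def)
  have below: "lt (A ! i) (B ! j)" if "j \<le> i" "i < q" for i
    using that j E_D(3)[OF assms(1), of j i] E_D(5)[OF assms(1)] E_D(5)[OF assms(2)] lt_trans
    by (metis le_neq_implies_less)
  show ?thesis
  proof
    show "B ! j \<in> set B" using j E_D(1)[OF assms(2)] by simp
    show "B ! j \<notin> set A"
    proof
      assume "B ! j \<in> set A"
      then obtain i where i: "i < q" "A ! i = B ! j"
        using E_D(1)[OF assms(1)] by (metis in_set_conv_nth)
      show False
      proof (cases "i < j")
        case True
        then have "lt (B ! j) (B ! i)" "B ! i = B ! j" using i j(1) j(2)[of i] E_D(3)[OF assms(2), of i j] by simp_all
        then show False using lt_irrefl E_D(5)[OF assms(2)] j by auto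
      next
        case False
        then show False using below[of i] i lt_irrefl E_D(5)[OF assms(2)] j by auto
      qed
    qed
    fix w assume w: "w \<in> set A" "w \<notin> set B"
    then obtain i where i: "i < q" "w = A ! i"
      using E_D(1)[OF assms(1)] by (metis in_set_conv_nth)
    with w have "\<not> i < j" using j(2)[of i] E_D(1)[OF assms(2)] by auto
    then show "lt w (B ! j)" using below i by auto
  qed
qed

lemma ext_total:
  assumes "A \<in> E" "B \<in> E" "A \<noteq> B"
  shows "ext_less lt A B \<or> ext_less lt B A"
proof -
  have len: "length A = q" "length B = q" using assms E_D by auto
  define j where "j = (LEAST j. j < q \<and> A ! j \<noteq> B ! j)"
  have ex: "\<exists>j. j < q \<and> A ! j \<noteq> B ! j" using assms(3) len by (metis nth_equalityI)
  have j: "j < q" "A ! j \<noteq> B ! j"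
    using LeastI_ex[OF ex] by (simp_all add: j_def)
  have "A ! i = B ! i" if "i < j" for i
    using not_less_Least[of i "\<lambda>j. j < q \<and> A ! j \<noteq> B ! j"] that j unfolding j_def by auto
  moreover have "lt (A ! j) (B ! j) \<or> lt (B ! j) (A ! j)"
    using j lt_total E_D(5) assms by blast
  ultimately show ?thesis
    using j len unfolding ext_less_def by (metis (no_types, lifting))
qed

text \<open>If the lists differed, the larger one would contain an element missing from the
  other.\<close>

lemma E_eqI:
  assumes "A \<in> E" "B \<in> E" "set A = set B"
  shows "A = B"
  using ext_total[OF assms(1,2)] ext_less_witness assms by metis

lemma ext_less_irrefl: "A \<in> E \<Longrightarrow> \<not> ext_less lt A A"
  using ext_less_witness by metis

lemma ext_less_trans:
  assumes "A \<in> E" "B \<in> E" "C \<in> E" "ext_less lt A B" "ext_less lt B C"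
  shows "ext_less lt A C"
proof -
  obtain i j where ij: "i < q" "\<And>k. k < i \<Longrightarrow> A ! k = B ! k" "lt (A ! i) (B ! i)"
    "j < q" "\<And>k. k < j \<Longrightarrow> B ! k = C ! k" "lt (B ! j) (C ! j)"
    using assms E_D(1) unfolding ext_less_def by metis
  have "lt (A ! min i j) (C ! min i j)"
    using ij lt_trans[of "A ! i" "B ! i" "C ! i"] E_D(5) assms(1-3)
    by (cases i j rule: linorder_cases) (auto simp: min_def)
  then show ?thesis
    using ij assms(1-3) E_D(1) unfolding ext_less_def by (intro exI[of _ "min i j"]) auto
qed

lemma E_max_exists:
  assumes "A \<subseteq> E" "A \<noteq> {}"
  obtains L where "L \<in> A" "\<And>M. M \<in> A \<Longrightarrow> M = L \<or> ext_less lt M L"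
proof -
  have "finite A" using finite_E assms(1) by (rule rev_finite_subset)
  moreover have "asymp_on A (ext_less lt)"
    using assms(1) ext_less_trans ext_less_irrefl by (intro asymp_onI) blast
  moreover have "transp_on A (ext_less lt)"
    using assms(1) ext_less_trans by (intro transp_onI) blast
  ultimately obtain L where L: "L \<in> A" "\<forall>M\<in>A. M \<noteq> L \<longrightarrow> \<not> ext_less lt L M"
    using Finite_Set.bex_max_element[of A "ext_less lt"] assms(2) by blast
  show ?thesis
    using that[OF L(1)] L assms(1) ext_total by blast
qed

text \<open>This evaluates the description operator in \<open>gin\<close>.\<close>

lemma E_max_unique:
  assumes "A \<subseteq> E" "L \<in> A" "\<And>M. M \<in> A \<Longrightarrow> M = L \<or> ext_less lt M L"
  shows "(THE L. L \<in> A \<and> (\<forall>M\<in>A. M = L \<or> ext_less lt M L)) = L"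
proof (rule the_equality)
  fix L' assume L': "L' \<in> A \<and> (\<forall>M\<in>A. M = L' \<or> ext_less lt M L')"
  then have "L' \<in> E" "L \<in> E" using assms(1,2) by blast+
  moreover have "L' = L \<or> ext_less lt L' L" "L = L' \<or> ext_less lt L L'"
    using L' assms(2) by (simp_all add: assms(3))
  ultimately show "L' = L"
    using ext_less_trans[of L' L L'] ext_less_irrefl[of L'] by argo
qed (use assms(2,3) in blast)

lemma E_exists:
  assumes "X \<subseteq> T" "card X = q"
  obtains L where "L \<in> E" "set L = X"
proof -
  have "\<exists>L. set L = X \<and> length L = card X \<and> sorted_wrt (\<lambda>s t. lt t s) L"
    if "X \<subseteq> T" for X
    using finite_subset[OF that finite_T] that
  proof (induction "card X" arbitrary: X)
    case (Suc k)
    have X: "y \<in> terms_S n" if "y \<in> X" for y using that Suc.prems T_subset by blast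
    have "asymp_on X lt"
      using X lt_asym by (intro asymp_onI) blast
    moreover have "transp_on X lt"
      using X lt_trans by (intro transp_onI) meson
    moreover have "X \<noteq> {}" using Suc.hyps(2) by auto
    ultimately obtain x where x: "x \<in> X" "\<forall>y\<in>X. y \<noteq> x \<longrightarrow> \<not> lt x y"
      using Finite_Set.bex_max_element[of X lt] Suc.prems(1) by blast
    obtain L where L: "set L = X - {x}" "length L = card (X - {x})" "sorted_wrt (\<lambda>s t. lt t s) L"
    proof -
      have "k = card (X - {x})" using Suc.hyps(2) Suc.prems x by simp
      from Suc.hyps(1)[OF this] Suc.prems that show ?thesis by blast
    qed
    have "lt y x" if "y \<in> X - {x}" for y
      using lt_total[of x y] X[of x] X[of y] x that by auto
    moreover have "Suc (card (X - {x})) = card X"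
      using x Suc.prems by (simp only: card_Suc_Diff1)
    ultimately show ?case
      using L x by (intro exI[of _ "x # L"]) auto
  qed auto
  from this[OF assms(1)] show ?thesis
    using assms that by (auto simp: ext_terms_def)
qed

section \<open>Linear substitutions\<close>

definition lin_form :: "'k::comm_ring_1 mat \<Rightarrow> nat \<Rightarrow> trm \<Rightarrow>\<^sub>0 'k"
  where "lin_form g i = (\<Sum>j\<le>n. pconst (g $$ (i, j)) * pvar j)"

text \<open>The matrix of \<open>g\<close> on the terms. Rows are sources: row \<open>t\<close>
  holds the coordinates of g(t), so composition of substitutions becomes a product of these matrices
  in the order of \<open>coef_mult\<close>.\<close>

definition coef :: "'k::comm_ring_1 mat \<Rightarrow> trm \<Rightarrow> trm \<Rightarrow> 'k"
  where "coef g t s = Poly_Mapping.lookup (pmon (lin_form g) t) s"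

lemma act_S_eq: "act_S n g f = psubst (lin_form g) f"
  by (simp add: act_S_def lin_form_def[abs_def])

lemma act_S_term: "act_S n g (Poly_Mapping.single t 1) = pmon (lin_form g) t"
  by (simp add: act_S_eq psubst_single)

lemma lookup_lin_form:
  "Poly_Mapping.lookup (lin_form g i) b = (\<Sum>j\<le>n. if b = xterm j then g $$ (i, j) else 0)"
  by (auto simp: lin_form_def lookup_sum lookup_pconst_mult pvar_def lookup_single xterm_def when_def
      intro!: sum.cong)

lemma keys_lin_form:
  assumes "b \<in> Poly_Mapping.keys (lin_form g i)"
  obtains j where "j \<le> n" "b = xterm j" "g $$ (i, j) \<noteq> 0"
proof -
  have "(\<Sum>j\<le>n. if b = xterm j then g $$ (i, j) else 0) \<noteq> 0"
    using assms by (simp add: in_keys_iff lookup_lin_form)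
  then obtain j where "j \<in> {..n}" "(if b = xterm j then g $$ (i, j) else 0) \<noteq> 0"
    by (rule sum.not_neutral_contains_not_neutral)
  then show ?thesis using that by (auto split: if_splits)
qed

lemma xterm_terms_S: "j \<le> n \<Longrightarrow> xterm j \<in> terms_S n"
  by (simp add: xterm_def terms_S_def)

lemma keys_pmon_lin_form:
  assumes "t \<in> T" "s \<in> Poly_Mapping.keys (pmon (lin_form g) t)"
  shows "s \<in> T"
proof -
  have "s \<in> terms_S n \<and> tdeg s = tdeg t"
  proof (rule pmon_keys[where R = "\<lambda>a b. b \<in> terms_S n \<and> tdeg b = tdeg a" and V = UNIV, OF _ _ _ _ assms(2)])
    fix v b assume "b \<in> Poly_Mapping.keys (lin_form g v)"
    then show "b \<in> terms_S n \<and> tdeg b = tdeg (Poly_Mapping.single v 1)"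
      by (elim keys_lin_form) (simp add: xterm_terms_S, simp add: xterm_def)
  qed (auto simp: tdeg_add terms_S_add)
  with assms(1) show ?thesis by (simp add: terms_deg_def)
qed

lemma psubst_lin_form:
  assumes "g \<in> carrier_mat (n + 1) (n + 1)" "h \<in> carrier_mat (n + 1) (n + 1)" "i \<le> n"
  shows "psubst (lin_form g) (lin_form h i) = lin_form (h * g) i"
proof -
  have "psubst (lin_form g) (lin_form h i) = (\<Sum>j\<le>n. pconst (h $$ (i, j)) * (\<Sum>k\<le>n. pconst (g $$ (j, k)) * pvar k))"
    unfolding lin_form_def[of h] by (simp add: psubst_sum psubst_mult) (simp add: lin_form_def)
  also have "\<dots> = (\<Sum>k\<le>n. (\<Sum>j\<le>n. pconst (h $$ (i, j) * g $$ (j, k))) * pvar k)"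
    unfolding sum_distrib_left sum_distrib_right
    by (subst sum.swap) (simp add: pconst_mult mult.assoc)
  also have "\<dots> = lin_form (h * g) i"
    unfolding lin_form_def
  proof (intro sum.cong refl arg_cong2[of _ _ _ _ "(*)"])
    fix k assume "k \<in> {..n}"
    with assms have "(h * g) $$ (i, k) = (\<Sum>j\<le>n. h $$ (i, j) * g $$ (j, k))"
      by (simp add: scalar_prod_def lessThan_Suc_atMost[symmetric] atLeast0LessThan)
    then show "(\<Sum>j\<le>n. pconst (h $$ (i, j) * g $$ (j, k))) = pconst ((h * g) $$ (i, k))"
      by (simp add: pconst_sum)
  qed
  finally show ?thesis .
qed

text \<open>The action is by substitution, so it reverses products of matrices.\<close>

lemma coef_mult:
  assumes "g \<in> carrier_mat (n + 1) (n + 1)" "h \<in> carrier_mat (n + 1) (n + 1)" "t \<in> T"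
  shows "coef (h * g) t s = (\<Sum>u\<in>T. coef h t u * coef g u s)"
proof -
  have t: "Poly_Mapping.keys t \<subseteq> {..n}"
    using assms(3) by (simp add: terms_deg_def terms_S_def)
  have "pmon (lin_form (h * g)) t = pmon (\<lambda>i. psubst (lin_form g) (lin_form h i)) t"
    using t psubst_lin_form[OF assms(1,2)] by (intro pmon_cong) auto
  also have "\<dots> = psubst (lin_form g) (pmon (lin_form h) t)"
    by (simp add: pmon_def psubst_prod psubst_power)
  also have "\<dots> = (\<Sum>u\<in>T. pconst (coef h t u) * pmon (lin_form g) u)"
    unfolding coef_def using keys_pmon_lin_form[OF assms(3)]
    by (intro psubst_superset finite_T) auto
  finally show ?thesis
    by (simp add: coef_def lookup_sum lookup_pconst_mult)
qed

section \<open>Characters of the diagonal torus\<close>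

definition chi :: "(nat \<Rightarrow> 'k::comm_ring_1) \<Rightarrow> trm \<Rightarrow> 'k"
  where "chi d t = (\<Prod>v\<le>n. d v ^ Poly_Mapping.lookup t v)"

lemma chi_add: "chi d (s + t) = chi d s * chi d t"
  by (simp add: chi_def lookup_add power_add prod.distrib)

lemma chi_mult: "chi (\<lambda>v. d v * e v) t = chi d t * chi e t"
  by (simp add: chi_def power_mult_distrib prod.distrib)

lemma chi_one [simp]: "chi (\<lambda>v. 1) t = 1"
  by (simp add: chi_def)

lemma chi_sum: "chi d (sum (\<lambda>t. t) X) = (\<Prod>t\<in>X. chi d t)"
  by (induction X rule: infinite_finite_induct) (simp_all add: chi_add, simp_all add: chi_def)

lemma coef_diag:
  assumes "t \<in> T"
  shows "coef (mat_diag (n + 1) d) t s = (if s = t then chi d t else 0)"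
proof -
  have t: "Poly_Mapping.keys t \<subseteq> {..n}"
    using assms by (simp add: terms_deg_def terms_S_def)
  have "lin_form (mat_diag (n + 1) d) i = pconst (d i) * pvar i" if "i \<le> n" for i
    using that by (simp add: lin_form_def mat_diag_def if_distrib[of pconst] if_distrib[of "\<lambda>x. x * _"] cong: if_cong)
  then have "pmon (lin_form (mat_diag (n + 1) d)) t = pmon (\<lambda>i. pconst (d i) * pvar i) t"
    using t by (intro pmon_cong) auto
  also have "\<dots> = pconst (chi d t) * pmon pvar t"
    using t by (simp add: pmon_superset[of "{..n}"] chi_def power_mult_distrib prod.distrib
      pconst_prod pconst_power)
  finally show ?thesis
    by (simp add: coef_def pmon_pvar pconst_mult_single lookup_single when_def)
qed

text \<open>The lists are not restricted to \<open>E\<close>, so that a minor can also be taken at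
  an unsorted or repeating tuple \<open>M\<close>, where it is alternating in the columns.\<close>

definition minor :: "(trm \<Rightarrow> trm \<Rightarrow> 'k::comm_ring_1) \<Rightarrow> trm list \<Rightarrow> trm list \<Rightarrow> 'k"
  where "minor c L M = det (Matrix.mat q q (\<lambda>(i, j). c (L ! i) (M ! j)))"

lemma lookup_act_ext:
  assumes "L \<in> E"
  shows "Poly_Mapping.lookup (act_ext n m q lt g (Poly_Mapping.single L 1)) M =
    (if M \<in> E then minor (coef g) L M else 0)"
proof -
  have "act_ext n m q lt g (Poly_Mapping.single L 1) =
      wedge n m q lt (map (\<lambda>t. act_S n g (Poly_Mapping.single t 1)) L)"
    by (rule poly_mapping_eqI) (simp add: act_ext_def Poly_Mapping.map.rep_eq when_def)
  moreover have "Matrix.mat q q (\<lambda>(i, j). Poly_Mapping.lookup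
      (map (\<lambda>t. act_S n g (Poly_Mapping.single t 1)) L ! i) (M ! j)) =
      Matrix.mat q q (\<lambda>(i, j). coef g (L ! i) (M ! j))"
    using E_D(1)[OF assms(1)] by (intro cong_mat) (auto simp: coef_def act_S_term)
  ultimately show ?thesis
    using finite_E by (simp add: wedge_def lookup_sum lookup_single when_def minor_def)
qed

abbreviation pullback :: "'k::comm_ring_1 mat \<Rightarrow> 'k plpoly \<Rightarrow> 'k plpoly"
  where "pullback \<equiv> plucker_pullback n m q lt"

definition pullback_var :: "'k::comm_ring_1 mat \<Rightarrow> trm list \<Rightarrow> 'k plpoly"
  where "pullback_var g M = (\<Sum>L\<in>E. pconst (Poly_Mapping.lookup (act_ext n m q lt g (Poly_Mapping.single L 1)) M) * pvar L)"

lemma pullback_eq: "pullback g = psubst (pullback_var g)"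
  by (simp add: plucker_pullback_def pullback_var_def[abs_def])

lemma pullback_var_minor: "M \<in> E \<Longrightarrow> pullback_var g M = (\<Sum>L\<in>E. pconst (minor (coef g) L M) * pvar L)"
  by (simp add: pullback_var_def lookup_act_ext)

lemma keys_pullback_var:
  assumes "b \<in> Poly_Mapping.keys (pullback_var g M)"
  obtains L where "L \<in> E" "b = Poly_Mapping.single L 1"
proof -
  from assms obtain L where "L \<in> E" "b \<in> Poly_Mapping.keys (pconst
      (Poly_Mapping.lookup (act_ext n m q lt g (Poly_Mapping.single L 1)) M) * pvar L)"
    unfolding pullback_var_def using keys_sum by fastforce
  then show ?thesis
    using that keys_pconst_mult by (fastforce simp: pvar_def split: if_splits)
qed

section \<open>Alternating functions of tuples of terms\<close>

text \<open>Unlike elements of \<open>E\<close>, these tuples may be unsorted and may repeat terms.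
  Sums over them factor position by position, which sums over \<open>E\<close> do not.\<close>

definition lists_T :: "nat \<Rightarrow> trm list set"
  where "lists_T k = {ts. set ts \<subseteq> T \<and> length ts = k}"

abbreviation "tuples \<equiv> lists_T q"

text \<open>Since \<open>E\<close> consists of descending lists, an inversion is an ascending pair.
  Their number is the exponent of the sign in \<open>plucker_alt\<close>.\<close>

definition inversions :: "trm list \<Rightarrow> (nat \<times> nat) set"
  where "inversions ts = {(i, j). i < j \<and> j < length ts \<and> lt (ts ! i) (ts ! j)}"

abbreviation "alt \<equiv> plucker_alt n m q lt"

lemma finite_lists_T: "finite (lists_T k)"
  using finite_lists_length_eq[OF finite_T, of k] by (simp add: lists_T_def)

lemma tuples_D:
  assumes "ts \<in> tuples"
  shows "length ts = q" "set ts \<subseteq> T" "\<And>i. i < q \<Longrightarrow> ts ! i \<in> T" "\<And>i. i < q \<Longrightarrow> ts ! i \<in> terms_S n"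
  using assms by (auto simp: lists_T_def T_subset dest: nth_mem)

lemma E_tuples: "L \<in> E \<Longrightarrow> L \<in> tuples"
  using E_D by (auto simp: lists_T_def)

lemma finite_inversions: "finite (inversions ts)"
  by (rule finite_subset[of _ "{..<length ts} \<times> {..<length ts}"]) (auto simp: inversions_def)

lemma inversions_E: "L \<in> E \<Longrightarrow> inversions L = {}"
  using E_D(1,3,5)[of L] lt_asym by (fastforce simp: inversions_def)

lemma permute_tuples: "ts \<in> tuples \<Longrightarrow> p permutes {..<q} \<Longrightarrow> permute_list p ts \<in> tuples"
  by (simp add: lists_T_def)

lemma tuples_sorted:
  assumes "ts \<in> tuples" "distinct ts" "\<And>i. Suc i < q \<Longrightarrow> \<not> lt (ts ! i) (ts ! Suc i)"
  shows "ts \<in> E"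
proof -
  \<comment> \<open>The order is transitive only on \<open>terms_S n\<close>, so membership is built
    into the relation to make it transitive on the whole type.\<close>
  let ?P = "\<lambda>s t. s \<in> T \<and> t \<in> T \<and> lt t s"
  have "transp ?P"
    using lt_trans T_subset by (intro transpI) blast
  moreover have "?P (ts ! i) (ts ! Suc i)" if "Suc i < length ts" for i
  proof -
    have "ts ! i \<noteq> ts ! Suc i"
      using assms(2) that by (simp add: nth_eq_iff_index_eq)
    then show ?thesis
      using that assms tuples_D[OF assms(1)] lt_total[of "ts ! i" "ts ! Suc i"] by auto
  qed
  ultimately have "sorted_wrt ?P ts"
    by (simp add: sorted_wrt_iff_nth_Suc_transp)
  then have "sorted_wrt (\<lambda>s t. lt t s) ts"
    by (rule sorted_wrt_mono_rel[rotated]) auto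
  then show ?thesis
    using assms by (simp add: ext_terms_def lists_T_def)
qed

text \<open>Exchanging two neighbouring positions preserves the relative position of every other
  pair. It therefore gives a bijection between the inversions of both lists, apart from the pair
  that is put in order.\<close>

lemma card_inversions_swap:
  assumes "ts \<in> tuples" "Suc k < q" "lt (ts ! k) (ts ! Suc k)"
  shows "card (inversions ts) = Suc (card (inversions (permute_list (transpose k (Suc k)) ts)))"
proof -
  let ?s = "transpose k (Suc k)"
  let ?us = "permute_list ?s ts"
  have len: "length ts = q" using assms tuples_D by blast
  have perm: "?s permutes {..<length ts}"
    using assms(2) len by (intro permutes_swap_id) auto
  have nth: "?us ! i = ts ! ?s i" if "i < q" for i
    using permute_list_nth[OF perm, of i] that len by simp
  have lt: "?s i < q" if "i < q" for i
    using that assms(2) by (auto simp: transpose_def)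
  have mono: "?s i < ?s j" if "i < j" "(i, j) \<noteq> (k, Suc k)" for i j
    using that by (auto simp: transpose_def)
  have notin: "(k, Suc k) \<notin> inversions ?us"
    using assms len lt_asym tuples_D[OF assms(1)] nth[of k] nth[of "Suc k"] by (auto simp: inversions_def)
  have "bij_betw (map_prod ?s ?s) (inversions ts - {(k, Suc k)}) (inversions ?us)"
  proof (rule bij_betw_byWitness[where f' = "map_prod ?s ?s"])
    show "map_prod ?s ?s ` (inversions ts - {(k, Suc k)}) \<subseteq> inversions ?us"
      using mono lt len by (auto simp: inversions_def nth)
    show "map_prod ?s ?s ` inversions ?us \<subseteq> inversions ts - {(k, Suc k)}"
    proof
      fix x assume "x \<in> map_prod ?s ?s ` inversions ?us"
      then obtain i j where ij: "(i, j) \<in> inversions ?us" and x: "x = (?s i, ?s j)"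
        by auto
      then have *: "i < j" "j < q" "(i, j) \<noteq> (k, Suc k)"
        using notin len by (auto simp: inversions_def)
      have "x \<in> inversions ts"
        using ij * mono lt len nth[of i] nth[of j] by (auto simp: inversions_def x)
      moreover have "x \<noteq> (k, Suc k)"
      proof
        assume "x = (k, Suc k)"
        then have "i = ?s k" "j = ?s (Suc k)" by (auto simp: x transpose_def split: if_splits)
        with * show False by simp
      qed
      ultimately show "x \<in> inversions ts - {(k, Suc k)}" by simp
    qed
  qed auto
  then have "card (inversions ts - {(k, Suc k)}) = card (inversions ?us)"
    by (rule bij_betw_same_card)
  moreover have "(k, Suc k) \<in> inversions ts"
    using assms len by (simp add: inversions_def)
  ultimately show ?thesis
    using finite_inversions[of ts] by (metis card_Suc_Diff1)
qed

text \<open>Bubble sort: each exchange of ascending neighbours changes the sign of \<open>F\<close>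
  and removes exactly one inversion. Functions with this sign rule are thus determined by their
  values on \<open>E\<close>, with the same sign as in \<open>plucker_alt\<close>.\<close>

lemma alternating_sort:
  fixes F :: "trm list \<Rightarrow> 'r::comm_ring_1"
  assumes F: "\<And>ts k. ts \<in> tuples \<Longrightarrow> Suc k < q \<Longrightarrow> F (permute_list (transpose k (Suc k)) ts) = - F ts"
    and "ts \<in> tuples" "distinct ts" "L \<in> E" "set L = set ts"
  shows "F ts = (-1) ^ card (inversions ts) * F L"
  using assms(2-)
proof (induction "card (inversions ts)" arbitrary: ts rule: less_induct)
  case less
  show ?case
  proof (cases "\<exists>k. Suc k < q \<and> lt (ts ! k) (ts ! Suc k)")
    case True
    then obtain k where k: "Suc k < q" "lt (ts ! k) (ts ! Suc k)" by blast
    let ?us = "permute_list (transpose k (Suc k)) ts"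
    have perm: "transpose k (Suc k) permutes {..<length ts}"
      using k tuples_D(1)[OF less.prems(1)] by (intro permutes_swap_id) auto
    have card: "card (inversions ts) = Suc (card (inversions ?us))"
      by (rule card_inversions_swap) (use k less.prems in auto)
    have "F ?us = (-1) ^ card (inversions ?us) * F L"
    proof (rule less.hyps)
      show "card (inversions ?us) < card (inversions ts)" using card by simp
      show "?us \<in> tuples" using perm less.prems(1) permute_tuples tuples_D(1) by metis
    qed (use perm less.prems in simp_all)
    moreover have "F ?us = - F ts" using F less.prems k by blast
    ultimately have "F ts = - ((-1) ^ card (inversions ?us) * F L)" by (metis minus_minus)
    then show ?thesis by (simp add: card)
  next
    case False
    then have "ts \<in> E" using tuples_sorted less.prems by blast
    then have "ts = L" using E_eqI less.prems by blast
    then show ?thesis using inversions_E less.prems by simp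
  qed
qed

lemma alt_distinct:
  assumes "ts \<in> tuples" "distinct ts" "L \<in> E" "set L = set ts"
  shows "alt ts = (-1) ^ card (inversions ts) * pvar L"
proof -
  have "(THE L. L \<in> E \<and> set L = set ts) = L"
    using assms E_eqI by (intro the_equality) auto
  then show ?thesis
    using assms by (simp add: plucker_alt_def inversions_def)
qed

lemma alt_E: "L \<in> E \<Longrightarrow> alt L = pvar L"
  using alt_distinct[of L L] by (simp add: E_tuples E_distinct inversions_E)

lemma alt_not_distinct: "\<not> distinct ts \<Longrightarrow> alt ts = 0"
  by (simp add: plucker_alt_def)

lemma det_permute_rows_fun:
  fixes f :: "nat \<Rightarrow> nat \<Rightarrow> 'r::comm_ring_1"
  assumes "p permutes {..<q}"
  shows "det (Matrix.mat q q (\<lambda>(i, j). f (p i) j)) = of_int (sign p) * det (Matrix.mat q q (\<lambda>(i, j). f i j))"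
proof -
  have p: "p permutes {0..<q}" using assms by (simp add: atLeast0LessThan)
  have "Matrix.mat q q (\<lambda>(i, j). f (p i) j) =
      Matrix.mat q q (\<lambda>(i, j). Matrix.mat q q (\<lambda>(i, j). f i j) $$ (p i, j))"
    using permutes_in_image[OF p] by (intro cong_mat) auto
  then show ?thesis
    using det_permute_rows[OF _ p, of "Matrix.mat q q (\<lambda>(i, j). f i j)"] by simp
qed

lemma det_permute_cols_fun:
  fixes f :: "nat \<Rightarrow> nat \<Rightarrow> 'r::comm_ring_1"
  assumes "p permutes {..<q}"
  shows "det (Matrix.mat q q (\<lambda>(i, j). f i (p j))) = of_int (sign p) * det (Matrix.mat q q (\<lambda>(i, j). f i j))"
proof -
  have tr: "det (Matrix.mat q q (\<lambda>(i, j). h i j)) = det (Matrix.mat q q (\<lambda>(i, j). h j i))"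
    for h :: "nat \<Rightarrow> nat \<Rightarrow> 'r"
  proof -
    have "transpose_mat (Matrix.mat q q (\<lambda>(i, j). h i j)) = Matrix.mat q q (\<lambda>(i, j). h j i)"
      by (rule eq_matI) auto
    then show ?thesis
      using det_transpose[of "Matrix.mat q q (\<lambda>(i, j). h i j)" q] by simp
  qed
  show ?thesis
    using det_permute_rows_fun[OF assms, of "\<lambda>i j. f j i"] tr[of "\<lambda>i j. f i (p j)"] tr[of f] by simp
qed

text \<open>The sign by inversions must be matched with \<open>sign p\<close>. Both are read off the
  determinant \<open>F\<close> of the 0/1 matrix comparing a tuple with \<open>L\<close>: it is 1 at
  \<open>L\<close>, permuting its rows yields \<open>sign p\<close>, and
  \<open>alternating_sort\<close> yields the inversion sign.\<close>

lemma alt_permute: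
  assumes "L \<in> E" "p permutes {..<q}"
  shows "alt (permute_list p L) = (of_int (sign p) * pvar L :: 'k::comm_ring_1 plpoly)"
proof -
  define F where "F ts = det (Matrix.mat q q (\<lambda>(i, j). if ts ! i = L ! j then 1 else 0 :: 'k plpoly))" for ts
  have perm: "F (permute_list p ts) = of_int (sign p) * F ts" if "ts \<in> tuples" "p permutes {..<q}" for ts p
  proof -
    have "F (permute_list p ts) = det (Matrix.mat q q (\<lambda>(i, j). if ts ! p i = L ! j then 1 else 0))"
      unfolding F_def using that tuples_D(1) 
      by (intro arg_cong[of _ _ det] cong_mat) (auto simp: permute_list_nth)
    then show ?thesis
      using det_permute_rows_fun[OF that(2), of "\<lambda>i j. if ts ! i = L ! j then 1 else 0"] by (simp add: F_def)
  qed
  have L: "L \<in> tuples" "distinct L" "length L = q" using assms E_tuples E_distinct E_D by auto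
  have perm_L: "permute_list p L \<in> tuples" "distinct (permute_list p L)" "set (permute_list p L) = set L"
    using assms L permute_tuples by simp_all
  have "Matrix.mat q q (\<lambda>(i, j). if L ! i = L ! j then 1 else 0 :: 'k plpoly) = 1\<^sub>m q"
    using L by (intro eq_matI) (auto simp: nth_eq_iff_index_eq)
  then have "F L = 1" by (simp add: F_def)
  moreover have "F (permute_list p L) = (-1) ^ card (inversions (permute_list p L)) * F L"
  proof (rule alternating_sort)
    fix ts k assume "ts \<in> tuples" "Suc k < q"
    moreover from this have "transpose k (Suc k) permutes {..<q}"
      by (intro permutes_swap_id) auto
    ultimately show "F (permute_list (transpose k (Suc k)) ts) = - F ts"
      using perm by (simp add: sign_swap_id)
  qed (use perm_L assms in auto)
  ultimately have "of_int (sign p) = ((-1) ^ card (inversions (permute_list p L)) :: 'k plpoly)"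
    using perm[OF L(1) assms(2)] by simp
  then show ?thesis
    using alt_distinct[OF perm_L(1,2) assms(1)] perm_L(3) by simp
qed

text \<open>An entry of the tensor power of the matrix \<open>c\<close>. It is unrelated to the
  torus weight of an extensor, which is the sum of the exponent vectors of its factors.\<close>

definition weight :: "(trm \<Rightarrow> trm \<Rightarrow> 'k::comm_ring_1) \<Rightarrow> trm list \<Rightarrow> trm list \<Rightarrow> 'k"
  where "weight c us ts = prod_list (map2 c us ts)"

lemma weight_nth:
  assumes "length us = k" "length ts = k"
  shows "weight c us ts = (\<Prod>i<k. c (us ! i) (ts ! i))"
  using assms by (simp add: weight_def prod.list_conv_set_nth atLeast0LessThan)

text \<open>Tuples with a repetition contribute 0, and every other tuple is a permutation of exactly
  one \<open>L\<close> in \<open>E\<close>. Collecting the permutations of \<open>L\<close> with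
  their signs gives the Leibniz formula for the minor.\<close>

lemma sum_minor_alt:
  fixes c :: "trm \<Rightarrow> trm \<Rightarrow> 'k::comm_ring_1"
  assumes "ts \<in> tuples"
  shows "(\<Sum>us\<in>tuples. pconst (weight c us ts) * alt us) = (\<Sum>L\<in>E. pconst (minor c L ts) * pvar L)"
proof -
  let ?P = "{p. p permutes {..<q}}"
  have len: "length ts = q" using assms tuples_D by blast
  have "(\<Sum>us\<in>tuples. pconst (weight c us ts) * alt us) =
      (\<Sum>us\<in>{us \<in> tuples. distinct us}. pconst (weight c us ts) * alt us)"
    by (rule sum.mono_neutral_right) (auto simp: finite_lists_T alt_not_distinct)
  also have "\<dots> = (\<Sum>(L, p)\<in>E \<times> ?P. pconst (weight c (permute_list p L) ts) * alt (permute_list p L))"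
  proof (subst sum.reindex_bij_betw[symmetric])
    show "bij_betw (\<lambda>(L, p). permute_list p L) (E \<times> ?P) {us \<in> tuples. distinct us}"
    proof (rule bij_betwI')
      fix x y assume xy: "x \<in> E \<times> ?P" "y \<in> E \<times> ?P"
      obtain L p L' p' where [simp]: "x = (L, p)" "y = (L', p')" by (cases x, cases y)
      have L: "L \<in> E" "L' \<in> E" "length L = q" "length L' = q" "distinct L" and p: "p permutes {..<q}" "p' permutes {..<q}"
        using xy E_D(1) E_distinct by auto
      have "L = L' \<and> p = p'" if eq: "permute_list p L = permute_list p' L'"
      proof -
        have "set L = set L'" using arg_cong[OF eq, of set] p L by simp
        then have [simp]: "L' = L" using E_eqI L by blast
        have "p i = p' i" for i
        proof (cases "i < q")
          case True
          then have "L ! p i = L ! p' i"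
            using arg_cong[OF eq, of "\<lambda>xs. xs ! i"] p L by (simp add: permute_list_nth)
          then show ?thesis
            using L p True permutes_in_image[OF p(1), of i] permutes_in_image[OF p(2), of i]
            by (simp add: nth_eq_iff_index_eq)
        next
          case False
          then show ?thesis using p by (simp add: permutes_def)
        qed
        then show ?thesis by auto
      qed
      then show "((case x of (L, p) \<Rightarrow> permute_list p L) = (case y of (L, p) \<Rightarrow> permute_list p L)) = (x = y)"
        by auto
    next
      fix x assume "x \<in> E \<times> ?P"
      then show "(case x of (L, p) \<Rightarrow> permute_list p L) \<in> {us \<in> tuples. distinct us}"
        using E_D(1) E_distinct E_tuples permute_tuples by auto
    next
      fix us assume us: "us \<in> {us \<in> tuples. distinct us}"
      then obtain L where L: "L \<in> E" "set L = set us"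
        using E_exists[of "set us"] by (auto simp: lists_T_def distinct_card)
      then have "mset us = mset L"
        using us E_distinct set_eq_iff_mset_eq_distinct[of us L] by auto
      then obtain p where "p permutes {..<length L}" "permute_list p L = us"
        by (rule mset_eq_permutation)
      then show "\<exists>x\<in>E \<times> ?P. us = (case x of (L, p) \<Rightarrow> permute_list p L)"
        using L E_D(1) by (intro bexI[of _ "(L, p)"]) auto
    qed
  qed (simp add: case_prod_unfold)
  also have "\<dots> = (\<Sum>L\<in>E. \<Sum>p\<in>?P. pconst (weight c (permute_list p L) ts) * alt (permute_list p L))"
    by (simp add: sum.cartesian_product)
  also have "\<dots> = (\<Sum>L\<in>E. pconst (minor c L ts) * pvar L)"
  proof (rule sum.cong[OF refl])
    fix L assume L: "L \<in> E"
    have "(\<Sum>p\<in>?P. pconst (weight c (permute_list p L) ts) * alt (permute_list p L)) =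
        (\<Sum>p\<in>?P. pconst (of_int (sign p) * (\<Prod>j<q. c (L ! p j) (ts ! j))) * pvar L)"
    proof (rule sum.cong[OF refl])
      fix p assume "p \<in> ?P"
      then have p: "p permutes {..<q}" by simp
      have "weight c (permute_list p L) ts = (\<Prod>j<q. c (L ! p j) (ts ! j))"
        using L E_D(1) len p by (simp add: weight_nth[of _ q] permute_list_nth)
      moreover have "pconst (of_int (sign p)) = (of_int (sign p) :: 'k plpoly)"
        by (cases "sign p = 1") (auto simp: sign_def pconst_uminus)
      ultimately show "pconst (weight c (permute_list p L) ts) * alt (permute_list p L) =
          pconst (of_int (sign p) * (\<Prod>j<q. c (L ! p j) (ts ! j))) * pvar L"
        by (simp add: alt_permute[OF L p] pconst_mult mult_ac)
    qed
    also have "\<dots> = pconst (\<Sum>p\<in>?P. of_int (sign p) * (\<Prod>j<q. c (L ! p j) (ts ! j))) * pvar L"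
      by (simp add: pconst_sum sum_distrib_right)
    also have "(\<Sum>p\<in>?P. of_int (sign p) * (\<Prod>j<q. c (L ! p j) (ts ! j))) = minor c L ts"
      unfolding minor_def
      by (subst det_col[of _ q]) (auto simp: atLeast0LessThan permutes_in_image intro!: sum.cong prod.cong)
    finally show "(\<Sum>p\<in>?P. pconst (weight c (permute_list p L) ts) * alt (permute_list p L)) =
        pconst (minor c L ts) * pvar L" .
  qed
  finally show ?thesis .
qed

text \<open>The sum equals the minor expression \<open>F\<close> by \<open>sum_minor_alt\<close>. On
  \<open>E\<close> this is the definition of the pullback, and both sides follow the same sign rule.
  The gain is that minors are replaced by products of matrix entries, which can be handled one
  position at a time.\<close>

lemma pullback_alt:
  assumes "ts \<in> tuples"
  shows "pullback g (alt ts) = (\<Sum>us\<in>tuples. pconst (weight (coef g) us ts) * alt us)"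
proof -
  define F where "F ts = (\<Sum>L\<in>E. pconst (minor (coef g) L ts) * pvar L)" for ts
  have "pullback g (alt ts) = F ts"
  proof (cases "distinct ts")
    case True
    then obtain L where L: "L \<in> E" "set L = set ts"
      using E_exists[of "set ts"] assms by (auto simp: lists_T_def distinct_card)
    have "F ts = (-1) ^ card (inversions ts) * F L"
    proof (rule alternating_sort)
      fix ts k assume ts: "ts \<in> tuples" "Suc k < q"
      then have p: "transpose k (Suc k) permutes {..<q}"
        by (intro permutes_swap_id) auto
      have "minor (coef g) L (permute_list (transpose k (Suc k)) ts) = - minor (coef g) L ts" for L
      proof -
        have "minor (coef g) L (permute_list (transpose k (Suc k)) ts) =
            det (Matrix.mat q q (\<lambda>(i, j). coef g (L ! i) (ts ! transpose k (Suc k) j)))"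
          unfolding minor_def using ts tuples_D(1) p
          by (intro arg_cong[of _ _ det] cong_mat) (auto simp: permute_list_nth)
        then show ?thesis
          using det_permute_cols_fun[OF p, of "\<lambda>i j. coef g (L ! i) (ts ! j)"]
          by (simp add: minor_def sign_swap_id)
      qed
      then show "F (permute_list (transpose k (Suc k)) ts) = - F ts"
        by (simp add: F_def pconst_uminus sum_negf)
    qed (use assms True L in auto)
    moreover have "psubst s ((- 1) ^ k) = (- 1) ^ k" for s :: "trm list \<Rightarrow> 'a plpoly" and k
      by (simp add: psubst_power psubst_uminus)
    ultimately show ?thesis
      using L(1) by (simp add: alt_distinct[OF assms True L] pullback_eq psubst_mult pullback_var_minor F_def)
  next
    case False
    \<comment> \<open>A repeated term gives two equal columns in every minor, in agreement with the
      value 0 of \<open>plucker_alt\<close>.\<close>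
    then obtain i j where ij: "i < q" "j < q" "i \<noteq> j" "ts ! i = ts ! j"
      using tuples_D(1)[OF assms] by (auto simp: distinct_conv_nth)
    have "minor (coef g) L ts = 0" for L
      unfolding minor_def
      by (rule det_identical_columns[of _ q i j]) (use ij in auto)
    then show ?thesis
      using False by (simp add: F_def alt_not_distinct pullback_eq)
  qed
  then show ?thesis
    by (simp add: F_def sum_minor_alt[OF assms])
qed

section \<open>Pullback of the Pluecker relations\<close>

lemma lists_T_0: "lists_T 0 = {[]}"
  by (auto simp: lists_T_def)

lemma sum_lists_T_Suc: "(\<Sum>us\<in>lists_T (Suc k). f us) = (\<Sum>u\<in>T. \<Sum>us\<in>lists_T k. f (u # us))"
proof -
  have "(\<Sum>us\<in>lists_T (Suc k). f us) = (\<Sum>(u, us)\<in>T \<times> lists_T k. f (u # us))"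
    by (rule sum.reindex_bij_witness[where i = "\<lambda>(u, us). u # us" and j = "\<lambda>us. (hd us, tl us)"])
      (auto simp: lists_T_def length_Suc_conv)
  then show ?thesis
    by (simp add: sum.cartesian_product)
qed

lemma weight_Cons [simp]: "weight c (u # us) (t # ts) = c u t * weight c us ts"
  by (simp add: weight_def)

lemma weight_Nil [simp]: "weight c [] [] = 1"
  by (simp add: weight_def)

lemma weight_append:
  "length us = length ts \<Longrightarrow> weight c (us @ us') (ts @ ts') = weight c us ts * weight c us' ts'"
  by (simp add: weight_def)

text \<open>Tensor powers are functorial: the sum over all tuples splits into one matrix product for
  each position.\<close>

lemma weight_compose:
  assumes "length ts = k" "length ws = k"
  shows "(\<Sum>us\<in>lists_T k. weight c us ts * weight d ws us) =
    weight (\<lambda>w t. \<Sum>u\<in>T. d w u * c u t) ws ts"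
  using assms
proof (induction k arbitrary: ts ws)
  case 0
  then show ?case by (simp add: lists_T_0)
next
  case (Suc k)
  then obtain t ts' w ws' where [simp]: "ts = t # ts'" "ws = w # ws'"
    and len: "length ts' = k" "length ws' = k"
    by (auto simp: length_Suc_conv)
  have "(\<Sum>us\<in>lists_T (Suc k). weight c us ts * weight d ws us) =
      (\<Sum>u\<in>T. \<Sum>us\<in>lists_T k. (d w u * c u t) * (weight c us ts' * weight d ws' us))"
    by (simp add: sum_lists_T_Suc mult_ac)
  also have "\<dots> = (\<Sum>u\<in>T. d w u * c u t) * (\<Sum>us\<in>lists_T k. weight c us ts' * weight d ws' us)"
    by (simp add: sum_product)
  finally show ?case
    using Suc.IH[OF len] by simp
qed

lemma weight_cong:
  assumes "\<And>u t. u \<in> T \<Longrightarrow> t \<in> T \<Longrightarrow> c u t = d u t" "set us \<subseteq> T" "set ts \<subseteq> T"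
  shows "weight c us ts = weight d us ts"
proof -
  have "map2 c us ts = map2 d us ts"
  proof (rule map_cong[OF refl])
    fix x assume "x \<in> set (zip us ts)"
    then obtain u t where "x = (u, t)" "u \<in> set us" "t \<in> set ts"
      by (metis prod.exhaust set_zip_leftD set_zip_rightD)
    with assms show "(case x of (u, t) \<Rightarrow> c u t) = (case x of (u, t) \<Rightarrow> d u t)"
      by auto
  qed
  then show ?thesis unfolding weight_def by (rule arg_cong)
qed

lemma pullback_sum: "pullback g (sum f A) = (\<Sum>a\<in>A. pullback g (f a))"
  by (simp add: pullback_eq psubst_sum)

lemma pullback_mult: "pullback g (a * b) = pullback g a * pullback g b"
  by (simp add: pullback_eq psubst_mult)

lemma pullback_pconst: "pullback g (pconst c) = pconst c"
  by (simp add: pullback_eq)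

text \<open>Expanding over all tuples takes the place of the Cauchy-Binet formula: the coefficients
  compose by \<open>weight_compose\<close> and \<open>coef_mult\<close>.\<close>

lemma pullback_pullback_pvar:
  assumes "g \<in> carrier_mat (n + 1) (n + 1)" "h \<in> carrier_mat (n + 1) (n + 1)" "M \<in> E"
  shows "pullback h (pullback g (pvar M)) = pullback (h * g) (pvar M)"
proof -
  have M: "M \<in> tuples" "length M = q" "set M \<subseteq> T" using assms E_tuples E_D by auto
  have "pullback h (pullback g (alt M)) =
      (\<Sum>us\<in>tuples. \<Sum>ws\<in>tuples. pconst (weight (coef g) us M * weight (coef h) ws us) * alt ws)"
    by (simp add: pullback_alt M pullback_sum pullback_mult pullback_pconst sum_distrib_left pconst_mult mult.assoc)
  also have "\<dots> = (\<Sum>ws\<in>tuples. pconst (\<Sum>us\<in>tuples. weight (coef g) us M * weight (coef h) ws us) * alt ws)"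
    by (subst sum.swap) (simp add: pconst_sum sum_distrib_right)
  also have "\<dots> = (\<Sum>ws\<in>tuples. pconst (weight (coef (h * g)) ws M) * alt ws)"
  proof (rule sum.cong[OF refl])
    fix ws assume ws: "ws \<in> tuples"
    have "(\<Sum>us\<in>tuples. weight (coef g) us M * weight (coef h) ws us) =
        weight (\<lambda>w t. \<Sum>u\<in>T. coef h w u * coef g u t) ws M"
      using M ws by (intro weight_compose) (auto simp: tuples_D)
    also have "\<dots> = weight (coef (h * g)) ws M"
      using M ws tuples_D(2) coef_mult[OF assms(1,2)] by (intro weight_cong) auto
    finally show "pconst (\<Sum>us\<in>tuples. weight (coef g) us M * weight (coef h) ws us) * alt ws =
        pconst (weight (coef (h * g)) ws M) * alt ws" by simp
  qed
  also have "\<dots> = pullback (h * g) (alt M)"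
    by (simp add: pullback_alt M)
  finally show ?thesis
    unfolding alt_E[OF assms(3)] .
qed

definition plucker_rel :: "trm list \<Rightarrow> trm list \<Rightarrow> 'k::comm_ring_1 plpoly"
  where "plucker_rel I J = (\<Sum>k\<le>q. (-1) ^ k * alt (I @ [J ! k]) * alt (take k J @ drop (Suc k) J))"

lemma plucker_relations_eq:
  "plucker_relations n m q lt = {plucker_rel I J | I J. I \<in> lists_T (q - 1) \<and> J \<in> lists_T (q + 1)}"
  if "q > 0"
  using that unfolding plucker_relations_def plucker_rel_def lists_T_def
  by (intro Collect_cong ex_cong1) auto

text \<open>Each summand of a Pluecker relation uses every entry of \<open>I\<close> and of
  \<open>J\<close> exactly once. All summands therefore acquire the same coefficients, and the
  pullback is a linear combination of Pluecker relations.\<close>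

lemma pullback_plucker_rel:
  assumes "q > 0" "I \<in> lists_T (q - 1)" "J \<in> lists_T (q + 1)"
  shows "pullback g (plucker_rel I J) = (\<Sum>I'\<in>lists_T (q - 1). \<Sum>J'\<in>lists_T (q + 1).
    pconst (weight (coef g) I' I * weight (coef g) J' J) * plucker_rel I' J')"
proof -
  let ?w = "weight (coef g)"
  let ?d = "\<lambda>k J. take k J @ drop (Suc k) J"
  have len: "length I = q - 1" "length J = q + 1" and sub: "set I \<subseteq> T" "set J \<subseteq> T"
    using assms by (auto simp: lists_T_def)
  have step: "pullback g (alt (I @ [J ! k])) * pullback g (alt (?d k J)) =
      (\<Sum>(I', J')\<in>lists_T (q - 1) \<times> lists_T (q + 1).
        pconst (?w I' I * ?w J' J) * (alt (I' @ [J' ! k]) * alt (?d k J')))"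
    if k: "k \<le> q" for k
  proof -
    have tup: "I @ [J ! k] \<in> tuples" "?d k J \<in> tuples"
      using len sub k assms(1) set_take_subset[of k J] set_drop_subset[of "Suc k" J]
      by (auto simp: lists_T_def)
    have "pullback g (alt (I @ [J ! k])) * pullback g (alt (?d k J)) =
        (\<Sum>(us, vs)\<in>tuples \<times> tuples.
          pconst (?w us (I @ [J ! k]) * ?w vs (?d k J)) * (alt us * alt vs))"
      unfolding pullback_alt[OF tup(1)] pullback_alt[OF tup(2)] sum_product sum.cartesian_product
      by (simp add: pconst_mult mult_ac)
    also have "\<dots> = (\<Sum>(I', J')\<in>lists_T (q - 1) \<times> lists_T (q + 1).
        pconst (?w I' I * ?w J' J) * (alt (I' @ [J' ! k]) * alt (?d k J')))"
    \<comment> \<open>The last entry of \<open>us\<close> corresponds to \<open>J ! k\<close>. It is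
      removed from \<open>us\<close> and inserted at position \<open>k\<close> of \<open>vs\<close>;
      the inverse moves the entry \<open>k\<close> of \<open>J'\<close> to the end of
      \<open>I'\<close>.\<close>
    proof (rule sum.reindex_bij_witness[where
          j = "\<lambda>(us, vs). (butlast us, take k vs @ last us # drop k vs)" and
          i = "\<lambda>(I', J'). (I' @ [J' ! k], ?d k J')"])
      fix x assume x: "x \<in> tuples \<times> tuples"
      obtain us vs where [simp]: "x = (us, vs)" by (cases x)
      from x have us: "length us = q" "set us \<subseteq> T" and vs: "length vs = q" "set vs \<subseteq> T"
        by (auto simp: lists_T_def)
      have ne: "us \<noteq> []" using us assms(1) by auto
      show "(case case x of (us, vs) \<Rightarrow> (butlast us, take k vs @ last us # drop k vs) of
          (I', J') \<Rightarrow> (I' @ [J' ! k], ?d k J')) = x"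
        using us vs k ne by (simp add: nth_append)
      show "(case x of (us, vs) \<Rightarrow> (butlast us, take k vs @ last us # drop k vs)) \<in>
          lists_T (q - 1) \<times> lists_T (q + 1)"
        using us vs k ne set_take_subset[of k vs] set_drop_subset[of k vs] last_in_set[OF ne]
        by (auto simp: lists_T_def dest: in_set_butlastD)
      have "?w us (I @ [J ! k]) = ?w (butlast us) I * ?w [last us] [J ! k]"
        using weight_append[of "butlast us" I "coef g" "[last us]" "[J ! k]"] ne us len by simp
      moreover have "?w vs (?d k J) = ?w (take k vs) (take k J) * ?w (drop k vs) (drop (Suc k) J)"
        using weight_append[of "take k vs" "take k J" "coef g" "drop k vs" "drop (Suc k) J"] vs len k
        by simp
      moreover have "?w (take k vs @ last us # drop k vs) J =
          ?w (take k vs) (take k J) * (coef g (last us) (J ! k) * ?w (drop k vs) (drop (Suc k) J))"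
        using weight_append[of "take k vs" "take k J" "coef g" "last us # drop k vs" "J ! k # drop (Suc k) J"]
          vs len k id_take_nth_drop[of k J] by simp
      ultimately show "(case case x of (us, vs) \<Rightarrow> (butlast us, take k vs @ last us # drop k vs) of
          (I', J') \<Rightarrow> pconst (?w I' I * ?w J' J) * (alt (I' @ [J' ! k]) * alt (?d k J'))) =
          (case x of (us, vs) \<Rightarrow> pconst (?w us (I @ [J ! k]) * ?w vs (?d k J)) * (alt us * alt vs))"
        using us vs k ne by (simp add: nth_append mult_ac)
    next
      fix x assume x: "x \<in> lists_T (q - 1) \<times> lists_T (q + 1)"
      obtain I' J' where [simp]: "x = (I', J')" by (cases x)
      from x have I': "length I' = q - 1" "set I' \<subseteq> T" and J': "length J' = q + 1" "set J' \<subseteq> T"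
        by (auto simp: lists_T_def)
      show "(case case x of (I', J') \<Rightarrow> (I' @ [J' ! k], ?d k J') of
          (us, vs) \<Rightarrow> (butlast us, take k vs @ last us # drop k vs)) = x"
        using J' k id_take_nth_drop[of k J'] by simp
      show "(case x of (I', J') \<Rightarrow> (I' @ [J' ! k], ?d k J')) \<in> tuples \<times> tuples"
        using I' J' k assms(1) set_take_subset[of k J'] set_drop_subset[of "Suc k" J']
        by (auto simp: lists_T_def)
    qed
    finally show ?thesis .
  qed
  have sgn: "pullback g ((-1) ^ k) = (-1) ^ k" for k
    by (simp add: pullback_eq psubst_power psubst_uminus)
  have "pullback g (plucker_rel I J) = (\<Sum>k\<le>q. (-1) ^ k * (pullback g (alt (I @ [J ! k])) * pullback g (alt (?d k J))))"
    by (simp add: plucker_rel_def pullback_sum pullback_mult sgn mult.assoc)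
  also have "\<dots> = (\<Sum>k\<le>q. \<Sum>(I', J')\<in>lists_T (q - 1) \<times> lists_T (q + 1).
        pconst (?w I' I * ?w J' J) * ((-1) ^ k * alt (I' @ [J' ! k]) * alt (?d k J')))"
    by (intro sum.cong refl) (simp add: step sum_distrib_left case_prod_unfold mult_ac)
  also have "\<dots> = (\<Sum>(I', J')\<in>lists_T (q - 1) \<times> lists_T (q + 1). pconst (?w I' I * ?w J' J) * plucker_rel I' J')"
    by (subst sum.swap) (simp add: plucker_rel_def sum_distrib_left case_prod_unfold)
  finally show ?thesis
    unfolding sum.cartesian_product .
qed

section \<open>Points of the Grassmannian\<close>

abbreviation "PR \<equiv> plucker_ring n m q lt"

lemma PR_simps [simp]:
  "add PR = (+)" "monoid.mult PR = (*)" "zero PR = 0" "one PR = 1"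
  by (simp_all add: plucker_ring_def)

lemma carrier_PR: "f \<in> carrier PR \<longleftrightarrow> (\<forall>a\<in>Poly_Mapping.keys f. Poly_Mapping.keys a \<subseteq> E)"
  by (simp add: plucker_ring_def)

lemma PR_add: "f \<in> carrier PR \<Longrightarrow> g \<in> carrier PR \<Longrightarrow> f + g \<in> carrier PR"
  using keys_add[of f g] by (auto simp: carrier_PR)

lemma PR_mult:
  assumes "f \<in> carrier PR" "g \<in> carrier PR"
  shows "f * g \<in> carrier PR"
  unfolding carrier_PR
proof
  fix c assume "c \<in> Poly_Mapping.keys (f * g)"
  then obtain a b where "a \<in> Poly_Mapping.keys f" "b \<in> Poly_Mapping.keys g" "c = a + b"
    by (rule keys_mult_elim)
  with assms keys_add[of a b] show "Poly_Mapping.keys c \<subseteq> E"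
    unfolding carrier_PR by blast
qed

lemma PR_pconst: "pconst c \<in> carrier PR"
  by (simp add: carrier_PR pconst_def)

lemma PR_one: "1 \<in> carrier PR"
  by (simp add: carrier_PR)

lemma PR_pvar: "L \<in> E \<Longrightarrow> pvar L \<in> carrier PR"
  by (simp add: carrier_PR pvar_def)

lemma PR_sum: "(\<And>a. a \<in> A \<Longrightarrow> f a \<in> carrier PR) \<Longrightarrow> sum f A \<in> carrier PR"
  by (induction A rule: infinite_finite_induct) (simp_all add: PR_add, simp_all add: carrier_PR)

lemma PR_power: "f \<in> carrier PR \<Longrightarrow> f ^ k \<in> carrier PR"
  by (induction k) (simp_all add: PR_mult PR_one)

lemma PR_prod: "(\<And>a. a \<in> A \<Longrightarrow> f a \<in> carrier PR) \<Longrightarrow> prod f A \<in> carrier PR"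
  by (induction A rule: infinite_finite_induct) (simp_all add: PR_mult PR_one)

lemma PR_alt: "ts \<in> tuples \<Longrightarrow> (alt ts :: 'k::comm_ring_1 plpoly) \<in> carrier PR"
proof (cases "distinct ts")
  case True
  assume ts: "ts \<in> tuples"
  then obtain L where L: "L \<in> E" "set L = set ts"
    using True E_exists[of "set ts"] by (auto simp: lists_T_def distinct_card)
  have "(-1 :: 'k plpoly) = pconst (-1)" by (simp add: pconst_uminus)
  then show ?thesis
    using L(1) by (simp add: alt_distinct[OF ts True L] PR_mult PR_power PR_pconst PR_pvar)
next
  case False
  then show ?thesis by (simp add: alt_not_distinct carrier_PR)
qed

lemma PR_pullback: "f \<in> carrier PR \<Longrightarrow> pullback g f \<in> carrier PR"
  unfolding pullback_eq psubst_def pullback_var_def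
  by (intro PR_sum PR_mult PR_prod PR_power PR_pconst PR_pvar)

lemma hom_component_carrier: "f \<in> carrier PR \<Longrightarrow> hom_component d f \<in> carrier PR"
  by (auto simp: carrier_PR in_keys_iff lookup_hom_component split: if_splits)

abbreviation "Gr \<equiv> Gr_points n m q lt"

context
  fixes P :: "'k::field plpoly set"
  assumes P: "P \<in> Gr"
begin

lemma Gr_prime: "primeideal P PR"
  using P by (simp add: Gr_points_def)

lemma Gr_subset: "f \<in> P \<Longrightarrow> f \<in> carrier PR"
  by (rule ideal.Icarr[OF primeideal.axioms(1)[OF Gr_prime]])

lemma Gr_zero: "0 \<in> P"
  using additive_subgroup.zero_closed[OF ideal.axioms(1)[OF primeideal.axioms(1)[OF Gr_prime]]] by simp

lemma Gr_add: "f \<in> P \<Longrightarrow> g \<in> P \<Longrightarrow> f + g \<in> P"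
  using additive_subgroup.a_closed[OF ideal.axioms(1)[OF primeideal.axioms(1)[OF Gr_prime]]] by simp

lemma Gr_mult: "f \<in> carrier PR \<Longrightarrow> g \<in> P \<Longrightarrow> f * g \<in> P"
  using ideal.I_l_closed[OF primeideal.axioms(1)[OF Gr_prime]] by simp

lemma Gr_prime_mult: "f \<in> carrier PR \<Longrightarrow> g \<in> carrier PR \<Longrightarrow> f * g \<in> P \<Longrightarrow> f \<in> P \<or> g \<in> P"
  using primeideal.I_prime[OF Gr_prime] by simp

lemma Gr_pconst: "f \<in> P \<Longrightarrow> pconst c * f \<in> P"
  by (simp add: Gr_mult PR_pconst)

lemma Gr_uminus: "f \<in> P \<Longrightarrow> - f \<in> P"
  using Gr_pconst[of f "-1"] by (simp add: pconst_uminus)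

lemma Gr_diff: "f \<in> P \<Longrightarrow> g \<in> P \<Longrightarrow> f - g \<in> P"
  using Gr_add[of f "- g"] Gr_uminus by simp

lemma Gr_sum: "(\<And>a. a \<in> A \<Longrightarrow> f a \<in> P) \<Longrightarrow> sum f A \<in> P"
  by (induction A rule: infinite_finite_induct) (simp_all add: Gr_add Gr_zero)

lemma Gr_pconst_cancel: "pconst c * f \<in> P \<Longrightarrow> c \<noteq> 0 \<Longrightarrow> f \<in> P"
  using Gr_pconst[of "pconst c * f" "inverse c"]
  by (simp add: mult.assoc[symmetric] pconst_mult[symmetric])

lemma Gr_sign_iff: "(-1) ^ k * f \<in> P \<longleftrightarrow> f \<in> P"
  using Gr_uminus[of f] Gr_uminus[of "- f"] by (cases "even k") auto

lemma Gr_plucker_rel: "q > 0 \<Longrightarrow> I \<in> lists_T (q - 1) \<Longrightarrow> J \<in> lists_T (q + 1) \<Longrightarrow> plucker_rel I J \<in> P"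
  using P plucker_relations_eq by (auto simp: Gr_points_def)

section \<open>Exchange, and the weights of the nonvanishing coordinates at a point\<close>

lemma Gr_alt_iff:
  assumes "ts \<in> tuples"
  shows "alt ts \<notin> P \<longleftrightarrow> distinct ts \<and> (\<exists>L\<in>E. set L = set ts \<and> pvar L \<notin> P)"
proof (cases "distinct ts")
  case True
  then obtain L where L: "L \<in> E" "set L = set ts"
    using assms E_exists[of "set ts"] by (auto simp: lists_T_def distinct_card)
  then have "alt ts \<notin> P \<longleftrightarrow> pvar L \<notin> P"
    by (simp add: alt_distinct[OF assms True L] Gr_sign_iff)
  then show ?thesis using True L E_eqI by metis
next
  case False
  then show ?thesis by (simp add: alt_not_distinct Gr_zero)
qed

text \<open>
  The Pluecker relation for \<open>L'\<close> without \<open>x\<close> and for \<open>L\<close> with \<open>x\<close> has \<open>\<plusminus>\<Delta>\<^sub>L\<^sub>' \<Delta>\<^sub>L\<close> as its term for \<open>x\<close>; this is a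
  nonzero term, so another one is nonzero, too.
\<close>

lemma exchange:
  assumes "q > 0" "L \<in> E" "L' \<in> E" "pvar L \<notin> P" "pvar L' \<notin> P" "x \<in> set L'" "x \<notin> set L"
  obtains y M M' where "y \<in> set L" "y \<notin> set L'"
    "M \<in> E" "set M = insert x (set L - {y})" "pvar M \<notin> P"
    "M' \<in> E" "set M' = insert y (set L' - {x})" "pvar M' \<notin> P"
proof -
  define I where "I = remove1 x L'"
  define J where "J = x # L"
  let ?f = "\<lambda>k. (-1) ^ k * alt (I @ [J ! k]) * (alt (take k J @ drop (Suc k) J) :: 'k plpoly)"
  have L: "length L = q" "distinct L" "set L \<subseteq> T" and L': "length L' = q" "distinct L'" "set L' \<subseteq> T"
    using assms E_D E_distinct by auto
  have I: "set I = set L' - {x}" "length I = q - 1" "distinct I"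
    using L' assms(6) by (auto simp: I_def length_remove1)
  have xT: "x \<in> T" using L' assms(6) by blast
  have tup: "I @ [J ! k] \<in> tuples" "take k J @ drop (Suc k) J \<in> tuples" if "k \<le> q" for k
  proof -
    have "J ! k \<in> set J" using that L by (intro nth_mem) (simp add: J_def)
    moreover have J: "set J \<subseteq> T" using L xT by (simp add: J_def)
    ultimately show "I @ [J ! k] \<in> tuples"
      using I L' assms(1) by (auto simp: lists_T_def)
    show "take k J @ drop (Suc k) J \<in> tuples"
      using J L that set_take_subset[of k J] set_drop_subset[of "Suc k" J]
      by (auto simp: lists_T_def J_def)
  qed
  have "alt (I @ [x]) \<notin> P"
    using Gr_alt_iff[OF tup(1)[of 0]] I assms(3,5,6) by (auto simp: J_def insert_absorb)
  then have f0: "?f 0 \<notin> P"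
    using Gr_prime_mult[of "alt (I @ [x])" "alt L"] PR_alt[OF tup(1)[of 0]] PR_alt[OF E_tuples[OF assms(2)]]
      assms(4) by (auto simp: J_def alt_E assms(2))
  have "\<exists>k\<in>{..q} - {0}. ?f k \<notin> P"
  proof (rule ccontr)
    assume "\<not> ?thesis"
    then have "(\<Sum>k\<in>{..q} - {0}. ?f k) \<in> P" by (intro Gr_sum) blast
    moreover have "I \<in> lists_T (q - 1)" "J \<in> lists_T (q + 1)"
      using I L xT L' by (auto simp: lists_T_def J_def)
    then have "plucker_rel I J \<in> P"
      by (rule Gr_plucker_rel[OF assms(1)])
    ultimately have "plucker_rel I J - (\<Sum>k\<in>{..q} - {0}. ?f k) \<in> P"
      by (rule Gr_diff[rotated])
    moreover have "plucker_rel I J = ?f 0 + (\<Sum>k\<in>{..q} - {0}. ?f k)"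
      unfolding plucker_rel_def by (rule sum.remove) auto
    ultimately show False using f0 by simp
  qed
  then obtain l where l: "l \<le> q" "l \<noteq> 0" "?f l \<notin> P" by blast
  then obtain k where [simp]: "l = Suc k" by (cases l) auto
  have k: "Suc k \<le> q" "?f (Suc k) \<notin> P" using l by simp_all
  \<comment> \<open>The head of \<open>J\<close> is \<open>x\<close>, so position
    \<open>Suc k\<close> of \<open>J\<close> is position \<open>k\<close> of
    \<open>L\<close>.\<close>
  define y where "y = L ! k"
  have y: "y \<in> set L" using k L by (simp add: y_def)
  have notin: "alt (I @ [y]) \<notin> P" "alt (x # (take k L @ drop (Suc k) L)) \<notin> P"
  proof -
    have "(-1) ^ Suc k * (alt (I @ [y]) * alt (x # (take k L @ drop (Suc k) L))) \<notin> P"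
      using k(2) by (simp only: J_def y_def mult.assoc nth_Cons_Suc take_Suc_Cons drop_Suc_Cons append_Cons)
        simp
    then have prod: "alt (I @ [y]) * alt (x # (take k L @ drop (Suc k) L)) \<notin> P"
      by (simp only: Gr_sign_iff) simp
    have "(alt (I @ [y]) :: 'k plpoly) \<in> carrier PR"
      "(alt (x # (take k L @ drop (Suc k) L)) :: 'k plpoly) \<in> carrier PR"
      using PR_alt[OF tup(1)[OF k(1)], where 'k = 'k] PR_alt[OF tup(2)[OF k(1)], where 'k = 'k]
      by (simp_all add: J_def y_def)
    then show "alt (I @ [y]) \<notin> P" "alt (x # (take k L @ drop (Suc k) L)) \<notin> P"
      using prod Gr_mult mult.commute by metis+
  qed
  \<comment> \<open>A nonvanishing \<open>alt\<close> forces its tuple to be distinct, so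
    \<open>y\<close> is not in \<open>I\<close>. As \<open>y\<close> lies in \<open>L\<close> and
    \<open>x\<close> does not, \<open>y\<close> is not in \<open>L'\<close> either.\<close>
  obtain M' where M': "M' \<in> E" "set M' = insert y (set L' - {x})" "pvar M' \<notin> P" "y \<notin> set L' - {x}"
    using Gr_alt_iff[OF tup(1)[OF k(1)]] notin(1) I by (auto simp: J_def y_def)
  obtain M where M: "M \<in> E" "set M = insert x (set L - {y})" "pvar M \<notin> P"
    using Gr_alt_iff[OF tup(2)[OF k(1)]] notin(2) set_delete_nth[of L k] L k
    by (auto simp: J_def y_def)
  show ?thesis
    using that[OF y _ M M'(1-3)] M'(4) assms(7) y by blast
qed

text \<open>Exchange yields \<open>M\<close>, which is \<open>L\<close> with \<open>y\<close>
  replaced by \<open>x\<close>, and \<open>M'\<close>, which is \<open>L'\<close> with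
  \<open>x\<close> replaced by \<open>y\<close>. Maximality of \<open>L\<close> against
  \<open>M\<close> forces \<open>x\<close> below \<open>y\<close>, so \<open>M'\<close> has a larger
  weight than \<open>L'\<close> and shares one more factor with \<open>L\<close>.\<close>

lemma weight_below_initial:
  assumes "q > 0" "L \<in> E" "pvar L \<notin> P" "\<And>M. M \<in> E \<Longrightarrow> pvar M \<notin> P \<Longrightarrow> M = L \<or> ext_less lt M L"
    and "L' \<in> E" "pvar L' \<notin> P" "L' \<noteq> L"
  shows "lt (\<Sum>t\<in>set L'. t) (\<Sum>t\<in>set L. t)"
  using assms(5-7)
proof (induction "card (set L' - set L)" arbitrary: L' rule: less_induct)
  case less
  have "set L' \<noteq> set L" using less.prems E_eqI assms(2) by blast
  \<comment> \<open>Both sets have \<open>q\<close> elements, so neither of two different ones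
    contains the other.\<close>
  then obtain x where x: "x \<in> set L'" "x \<notin> set L"
    using E_card[OF less.prems(1)] E_card[OF assms(2)] card_subset_eq[of "set L" "set L'"] by auto
  obtain y M M' where y: "y \<in> set L" "y \<notin> set L'"
    and M: "M \<in> E" "set M = insert x (set L - {y})" "pvar M \<notin> P"
    and M': "M' \<in> E" "set M' = insert y (set L' - {x})" "pvar M' \<notin> P"
    using exchange[OF assms(1,2) less.prems(1) assms(3) less.prems(2) x] by blast
  have "ext_less lt M L"
    using assms(4)[OF M(1,3)] M(2) x by blast
  then obtain z where "z \<in> set L" "z \<notin> set M" "\<And>w. w \<in> set M \<Longrightarrow> w \<notin> set L \<Longrightarrow> lt w z"
    using ext_less_witness[OF M(1) assms(2)] by blast
  \<comment> \<open>The only factor of \<open>L\<close> missing from \<open>M\<close> is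
    \<open>y\<close>, so the witness \<open>z\<close> is \<open>y\<close>.\<close>
  then have xy: "lt x y" using M(2) x by auto
  have E_S: "t \<in> terms_S n" if "N \<in> E" "t \<in> set N" for N t
    using E_D(2)[OF that(1)] that(2) T_subset by blast
  have S: "x \<in> terms_S n" "y \<in> terms_S n" "(\<Sum>t\<in>set L' - {x}. t) \<in> terms_S n"
    using E_S[OF less.prems(1)] E_S[OF assms(2)] x y by (auto intro!: terms_S_sum)
  have S': "(\<Sum>t\<in>set N. t) \<in> terms_S n" if "N \<in> E" for N
    using E_S[OF that] by (rule terms_S_sum)
  have "lt (x + (\<Sum>t\<in>set L' - {x}. t)) (y + (\<Sum>t\<in>set L' - {x}. t))"
    using lt_add xy S by blast
  moreover have "(\<Sum>t\<in>set L'. t) = x + (\<Sum>t\<in>set L' - {x}. t)"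
    using x by (simp add: sum.remove)
  moreover have "(\<Sum>t\<in>set M'. t) = y + (\<Sum>t\<in>set L' - {x}. t)"
    using M' y by simp
  ultimately have lt1: "lt (\<Sum>t\<in>set L'. t) (\<Sum>t\<in>set M'. t)" by simp
  show ?case
  proof (cases "M' = L")
    case False
    have "set M' - set L = set L' - set L - {x}" using M' y by auto
    then have "card (set M' - set L) < card (set L' - set L)"
      using x by (simp only:) (rule card_Diff1_less, simp_all)
    then have "lt (\<Sum>t\<in>set M'. t) (\<Sum>t\<in>set L. t)"
      using less.hyps M' False by blast
    then show ?thesis
      using lt1 lt_trans S'[OF less.prems(1)] S'[OF M'(1)] S'[OF assms(2)] by blast
  qed (use lt1 in simp)
qed

end

section \<open>Group action, torus and triangular matrices\<close>

text \<open>A diagonal matrix scales each term, so in the sum over tuples only \<open>M\<close>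
  itself survives, and the scalars of its factors multiply to the character of its weight.\<close>

lemma pullback_diag:
  assumes "M \<in> E"
  shows "pullback (mat_diag (n + 1) d) (pvar M) = pconst (chi d (\<Sum>t\<in>set M. t)) * pvar M"
proof -
  define D where "D = mat_diag (n + 1) d"
  have coef: "coef D t s = (if s = t then chi d t else 0)" if "t \<in> T" for t s
    unfolding D_def by (rule coef_diag[OF that])
  have M: "M \<in> tuples" "length M = q" using assms E_tuples E_D by auto
  have "weight (coef D) us M = (if us = M then chi d (\<Sum>t\<in>set M. t) else 0)"
    if us: "us \<in> tuples" for us
  proof -
    have w: "weight (coef D) us M = (\<Prod>i<q. if M ! i = us ! i then chi d (us ! i) else 0)"
      using M tuples_D[OF us] by (simp add: weight_nth[of _ q] coef)
    show ?thesis
    proof (cases "us = M")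
      case True
      have "(\<Prod>i<q. chi d (M ! i)) = (\<Prod>t\<in>set M. chi d t)"
        using M E_distinct[OF assms] by (simp add: prod.distinct_set_conv_list prod.list_conv_set_nth atLeast0LessThan)
      then show ?thesis unfolding w using True by (simp add: chi_sum)
    next
      case False
      then obtain i where "i < q" "us ! i \<noteq> M ! i"
        using us M tuples_D(1) by (metis nth_equalityI)
      then have "\<exists>i\<in>{..<q}. (if M ! i = us ! i then chi d (us ! i) else 0) = 0"
        by (intro bexI[of _ i]) auto
      then have "(\<Prod>i<q. if M ! i = us ! i then chi d (us ! i) else 0) = 0"
        by (intro prod_zero) auto
      then show ?thesis using False w by simp
    qed
  qed
  then have "pullback D (alt M) =
      (\<Sum>us\<in>tuples. if us = M then pconst (chi d (\<Sum>t\<in>set M. t)) * alt us else 0)"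
    unfolding pullback_alt[OF M(1)] by (intro sum.cong refl) simp
  also have "\<dots> = pconst (chi d (\<Sum>t\<in>set M. t)) * alt M"
    using M finite_lists_T by simp
  finally show ?thesis
    unfolding alt_E[OF assms] D_def .
qed

lemma pullback_one:
  assumes "M \<in> E"
  shows "pullback (1\<^sub>m (n + 1)) (pvar M) = (pvar M :: 'k::comm_ring_1 plpoly)"
proof -
  have "1\<^sub>m (n + 1) = mat_diag (n + 1) (\<lambda>i. 1 :: 'k)"
    by (rule eq_matI) (auto simp: mat_diag_def)
  then show ?thesis
    using pullback_diag[OF assms, of "\<lambda>i. 1 :: 'k"] by (simp only: chi_one pconst_simps mult_1_left)
qed

section \<open>The group action on the points\<close>

abbreviation act :: "'k::comm_ring_1 mat \<Rightarrow> 'k plpoly set \<Rightarrow> 'k plpoly set"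
  where "act \<equiv> act_Gr n m q lt"

lemma GL_mat_iff:
  "g \<in> GL_mat n \<longleftrightarrow> g \<in> carrier_mat (n + 1) (n + 1) \<and>
    (\<exists>h\<in>carrier_mat (n + 1) (n + 1). g * h = 1\<^sub>m (n + 1) \<and> h * g = 1\<^sub>m (n + 1))"
  (is "?l = ?r")
proof
  assume ?l
  then have g: "g \<in> carrier_mat (n + 1) (n + 1)" "invertible_mat g" by (auto simp: GL_mat_def)
  then obtain h where h: "g * h = 1\<^sub>m (dim_row g)" "h * g = 1\<^sub>m (dim_row h)"
    by (auto simp: invertible_mat_def inverts_mat_def)
  \<comment> \<open>\<open>invertible_mat\<close> says nothing about the size of the inverse; it is
    read off the two identity matrices.\<close>
  have "dim_col h = n + 1" using arg_cong[OF h(1), of dim_col] g by simp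
  moreover have "dim_row h = n + 1" using arg_cong[OF h(2), of dim_col] g by simp
  ultimately show ?r using g h by (metis carrier_matD(1) carrier_matI)
next
  assume ?r
  then show ?l by (auto simp: GL_mat_def invertible_mat_def inverts_mat_def square_mat.simps)
qed

lemma GL_carrier: "g \<in> GL_mat n \<Longrightarrow> g \<in> carrier_mat (n + 1) (n + 1)"
  by (simp add: GL_mat_def)

lemma GL_mult:
  assumes "g \<in> GL_mat n" "h \<in> GL_mat n"
  shows "g * h \<in> GL_mat n"
proof -
  let ?C = "carrier_mat (n + 1) (n + 1)"
  obtain g' h' where g: "g \<in> ?C" "g' \<in> ?C" "g * g' = 1\<^sub>m (n + 1)" "g' * g = 1\<^sub>m (n + 1)"
    and h: "h \<in> ?C" "h' \<in> ?C" "h * h' = 1\<^sub>m (n + 1)" "h' * h = 1\<^sub>m (n + 1)"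
    using assms by (auto simp: GL_mat_iff)
  have inv: "(a * b) * (b' * a') = 1\<^sub>m (n + 1)"
    if "a \<in> ?C" "b \<in> ?C" "b' \<in> ?C" "a' \<in> ?C" "b * b' = 1\<^sub>m (n + 1)" "a * a' = 1\<^sub>m (n + 1)"
    for a b a' b' :: "'a mat"
  proof -
    have "(a * b) * (b' * a') = a * (b * (b' * a'))"
      using that by (intro assoc_mult_mat[of _ _ "n + 1" _ "n + 1" _ "n + 1"]) auto
    also have "b * (b' * a') = (b * b') * a'"
      using that by (intro assoc_mult_mat[symmetric, of _ _ "n + 1" _ "n + 1" _ "n + 1"]) auto
    finally show ?thesis using that by simp
  qed
  have "h' * g' \<in> ?C" "g * h \<in> ?C" using g h by auto
  then show ?thesis
    unfolding GL_mat_iff using inv[of g h h' g'] inv[of h' g' g h] g h by blast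
qed

lemma GL_one: "1\<^sub>m (n + 1) \<in> GL_mat n"
  unfolding GL_mat_iff by (intro conjI bexI[of _ "1\<^sub>m (n + 1)"]) auto

lemma GL_diag:
  fixes d :: "nat \<Rightarrow> 'k::field"
  assumes "\<And>i. d i \<noteq> 0"
  shows "mat_diag (n + 1) d \<in> GL_mat n"
proof -
  have one: "mat_diag (n + 1) (\<lambda>i. 1) = (1\<^sub>m (n + 1) :: 'k mat)"
    by (rule eq_matI) (auto simp: mat_diag_def)
  have "mat_diag (n + 1) d * mat_diag (n + 1) (\<lambda>i. inverse (d i)) = 1\<^sub>m (n + 1)"
    "mat_diag (n + 1) (\<lambda>i. inverse (d i)) * mat_diag (n + 1) d = 1\<^sub>m (n + 1)"
    using assms by (simp_all only: mat_diag_diag one[symmetric] right_inverse left_inverse not_False_eq_True)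
  then show ?thesis
    unfolding GL_mat_iff by (meson mat_diag_dim)
qed

lemma pullback_pullback:
  assumes "g \<in> carrier_mat (n + 1) (n + 1)" "h \<in> carrier_mat (n + 1) (n + 1)" "f \<in> carrier PR"
  shows "pullback h (pullback g f) = pullback (h * g) f"
proof -
  have "pullback h (pullback g f) = psubst (\<lambda>v. pullback h (pullback_var g v)) f"
    by (simp add: pullback_eq psubst_psubst)
  also have "\<dots> = psubst (pullback_var (h * g)) f"
  proof (rule psubst_cong)
    fix a v assume "a \<in> Poly_Mapping.keys f" "v \<in> Poly_Mapping.keys a"
    then have "v \<in> E" using assms(3) by (auto simp: carrier_PR)
    then show "pullback h (pullback_var g v) = pullback_var (h * g) v"
      using pullback_pullback_pvar[OF assms(1,2)] by (simp add: pullback_eq)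
  qed
  finally show ?thesis by (simp add: pullback_eq)
qed

text \<open>Here \<open>h\<close> acts first. The product comes out as \<open>h * g\<close> because
  matrices act by substitution.\<close>

lemma act_act:
  assumes "g \<in> GL_mat n" "h \<in> GL_mat n"
  shows "act g (act h P) = act (h * g) P"
  using pullback_pullback[OF GL_carrier[OF assms(1)] GL_carrier[OF assms(2)]] PR_pullback
  by (auto simp: act_Gr_def)

lemma pvar_act: "M \<in> E \<Longrightarrow> pvar M \<in> act g P \<longleftrightarrow> pullback g (pvar M) \<in> P"
  by (simp add: act_Gr_def PR_pvar)

text \<open>The preimage of a prime ideal under a ring homomorphism is prime; linear substitution
  respects degrees; Pluecker relations are pulled back to combinations of Pluecker relations; and
  invertibility of \<open>g\<close> keeps some coordinate nonzero.\<close>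

lemma act_Gr_points:
  fixes P :: "'k::field plpoly set"
  assumes "q > 0" "P \<in> Gr" "g \<in> GL_mat n"
  shows "act g P \<in> Gr"
proof -
  \<comment> \<open>Being a prime ideal includes that the ambient ring is commutative, so the point
    itself supplies this.\<close>
  have cring: "cring (PR :: 'k plpoly ring)"
    using Gr_prime[OF assms(2)] by (rule primeideal.axioms(2))
  have "primeideal {f \<in> carrier PR. pullback g f \<in> P} PR"
  proof (rule ring_hom_ring.primeideal_vimage[OF _ cring Gr_prime[OF assms(2)]])
    have "pullback g \<in> Ring.ring_hom (PR :: 'k plpoly ring) PR"
      by (rule ring_hom_memI) (simp_all add: PR_pullback pullback_mult, simp_all add: pullback_eq psubst_add)
    then show "ring_hom_ring (PR :: 'k plpoly ring) PR (pullback g)"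
      using cring.axioms(1)[OF cring] by (intro ring_hom_ringI2)
  qed
  then have 1: "primeideal (act g P) PR" by (simp add: act_Gr_def)
  have 2: "hom_component d f \<in> act g P" if "f \<in> act g P" for f d
  proof -
    have "hom_component d (pullback g f) = pullback g (hom_component d f)"
      unfolding pullback_eq
    proof (rule hom_component_psubst)
      fix v b assume "b \<in> Poly_Mapping.keys (pullback_var g v)"
      then show "tdeg b = 1" by (rule keys_pullback_var) simp
    qed
    moreover have "hom_component d (pullback g f) \<in> P"
      using assms(2) that by (simp add: Gr_points_def act_Gr_def)
    ultimately show ?thesis
      using that by (simp add: act_Gr_def hom_component_carrier)
  qed
  have 3: "plucker_relations n m q lt \<subseteq> act g P"
  proof
    fix r :: "'k plpoly" assume "r \<in> plucker_relations n m q lt"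
    then obtain I J where r: "r = plucker_rel I J" "I \<in> lists_T (q - 1)" "J \<in> lists_T (q + 1)"
      unfolding plucker_relations_eq[OF assms(1)] by blast
    have "pullback g r \<in> P"
      unfolding r(1) pullback_plucker_rel[OF assms(1) r(2,3)]
      by (intro Gr_sum[OF assms(2)] Gr_pconst[OF assms(2)] Gr_plucker_rel[OF assms(2,1)])
    moreover have "r \<in> carrier PR"
      unfolding r(1) by (intro Gr_subset[OF assms(2)] Gr_plucker_rel[OF assms(2,1)] r(2,3))
    ultimately show "r \<in> act g P" by (simp add: act_Gr_def)
  qed
  have 4: "\<exists>L\<in>E. pvar L \<notin> act g P"
  proof (rule ccontr)
    assume "\<not> ?thesis"
    then have all: "pullback g (pvar L) \<in> P" if "L \<in> E" for L
      using that by (auto simp: pvar_act)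
    obtain h where h: "h \<in> carrier_mat (n + 1) (n + 1)" "g * h = 1\<^sub>m (n + 1)"
      using assms(3) by (auto simp: GL_mat_iff)
    \<comment> \<open>By the inverse matrix, every coordinate is a linear combination of the pulled
      back ones, so all coordinates would vanish at \<open>P\<close>.\<close>
    have "pvar M \<in> P" if M: "M \<in> E" for M
    proof -
      have "pullback g (pullback h (pvar M)) \<in> P"
        unfolding pullback_eq[of h] psubst_pvar pullback_var_def
        using all by (auto simp: pullback_sum pullback_mult pullback_pconst intro!: Gr_sum[OF assms(2)] Gr_pconst[OF assms(2)])
      then show ?thesis
        unfolding pullback_pullback_pvar[OF h(1) GL_carrier[OF assms(3)] M] h(2) pullback_one[OF M] .
    qed
    then show False using assms(2) by (auto simp: Gr_points_def)
  qed
  from 1 2 3 4 show ?thesis by (simp add: Gr_points_def)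
qed

text \<open>Choose a variable \<open>i\<close> in which the exponents differ, and let
  \<open>d\<close> be 1 except at \<open>i\<close>. The entry \<open>x\<close> there has to avoid 0
  and the finitely many roots of a nonzero polynomial, which is possible in an infinite
  field.\<close>

lemma chi_separates:
  fixes w1 w2 :: trm
  assumes "infinite (UNIV :: 'k::field set)" "w1 \<in> terms_S n" "w2 \<in> terms_S n" "w1 \<noteq> w2"
  obtains d :: "nat \<Rightarrow> 'k::field" where "\<And>i. d i \<noteq> 0" "chi d w1 \<noteq> chi d w2"
proof -
  obtain i where i: "Poly_Mapping.lookup w1 i \<noteq> Poly_Mapping.lookup w2 i"
    using assms(4) by (auto intro: poly_mapping_eqI)
  then have "i \<le> n"
    using assms(2,3) by (metis atMost_iff in_keys_iff mem_Collect_eq subsetD terms_S_def)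
  let ?a = "Poly_Mapping.lookup w1 i" and ?b = "Poly_Mapping.lookup w2 i"
  have "monom 1 ?a \<noteq> (monom 1 ?b :: 'k poly)"
    using i by (metis degree_monom_eq zero_neq_one)
  then have "finite {x. poly (monom 1 ?a - monom 1 ?b :: 'k poly) x = 0}"
    by (intro poly_roots_finite) simp
  then have "finite (insert 0 {x :: 'k. x ^ ?a = x ^ ?b})"
    by (simp add: poly_monom)
  then obtain x :: 'k where x: "x \<noteq> 0" "x ^ ?a \<noteq> x ^ ?b"
    using ex_new_if_finite[OF assms(1)] by blast
  have "chi ((\<lambda>_. 1)(i := x)) w = x ^ Poly_Mapping.lookup w i" for w
  proof -
    have "chi ((\<lambda>_. 1)(i := x)) w = (\<Prod>v\<le>n. if v = i then x ^ Poly_Mapping.lookup w v else 1)"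
      unfolding chi_def by (intro prod.cong) auto
    then show ?thesis using \<open>i \<le> n\<close> by simp
  qed
  then show ?thesis using that[of "(\<lambda>_. 1)(i := x)"] x by simp
qed

text \<open>Dedekind's argument, with values in the quotient by \<open>P\<close>.\<close>

lemma chi_independent:
  fixes P :: "'k::field plpoly set"
  assumes "infinite (UNIV :: 'k set)" "P \<in> Gr" "finite A" "A \<subseteq> terms_S n"
    and "\<And>d. (\<And>i. d i \<noteq> 0) \<Longrightarrow> (\<Sum>w\<in>A. pconst (chi d w) * F w) \<in> P"
    and "w \<in> A"
  shows "F w \<in> P"
  using assms(3-)
proof (induction A arbitrary: F w rule: finite_induct)
  case (insert w1 A)
  have rest: "F w2 \<in> P" if w2: "w2 \<in> A" for w2
  proof -
    obtain e :: "nat \<Rightarrow> 'k" where e: "\<And>i. e i \<noteq> 0" "chi e w1 \<noteq> chi e w2"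
      using chi_separates[OF assms(1), of w1 w2] insert.prems(1) insert.hyps w2 by auto
    \<comment> \<open>From the relation at the product of \<open>d\<close> and \<open>e\<close>,
      subtract \<open>chi e w1\<close> times the relation at \<open>d\<close>. This cancels
      \<open>w1\<close> and leaves a relation over \<open>A\<close> to which the induction
      hypothesis applies.\<close>
    have "pconst (chi e w2 - chi e w1) * F w2 \<in> P"
    proof (rule insert.IH[of "\<lambda>w. pconst (chi e w - chi e w1) * F w" w2])
      fix d :: "nat \<Rightarrow> 'k" assume d: "\<And>i. d i \<noteq> 0"
      have "(\<Sum>w\<in>insert w1 A. pconst (chi (\<lambda>i. d i * e i) w) * F w) -
          pconst (chi e w1) * (\<Sum>w\<in>insert w1 A. pconst (chi d w) * F w) \<in> P"
        using insert.prems(2)[of "\<lambda>i. d i * e i"] insert.prems(2)[of d] d e(1)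
        by (intro Gr_diff[OF assms(2)] Gr_pconst[OF assms(2)]) auto
      also have "(\<Sum>w\<in>insert w1 A. pconst (chi (\<lambda>i. d i * e i) w) * F w) -
          pconst (chi e w1) * (\<Sum>w\<in>insert w1 A. pconst (chi d w) * F w) =
          (\<Sum>w\<in>insert w1 A. pconst (chi d w) * (pconst (chi e w - chi e w1) * F w))"
        unfolding sum_distrib_left sum_subtractf[symmetric]
        by (intro sum.cong refl) (simp add: chi_mult pconst_mult pconst_add pconst_uminus
          diff_conv_add_uminus algebra_simps del: add_uminus_conv_diff)
      also have "\<dots> = (\<Sum>w\<in>A. pconst (chi d w) * (pconst (chi e w - chi e w1) * F w))"
        using insert.hyps by simp
      finally show "(\<Sum>w\<in>A. pconst (chi d w) * (pconst (chi e w - chi e w1) * F w)) \<in> P" .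
    qed (use insert.prems(1) w2 in simp_all)
    then show ?thesis
      by (rule Gr_pconst_cancel[OF assms(2)]) (use e(2) in simp)
  qed
  \<comment> \<open>The identity of the torus gives the plain sum of all \<open>F w\<close>;
    removing those already known to lie in \<open>P\<close> isolates \<open>F w1\<close>.\<close>
  have "(\<Sum>w\<in>insert w1 A. pconst (chi (\<lambda>_. 1) w) * F w) - (\<Sum>w\<in>A. F w) \<in> P"
    by (rule Gr_diff[OF assms(2) insert.prems(2) Gr_sum[OF assms(2) rest]]) simp_all
  then have "F w1 \<in> P" using insert.hyps by simp
  then show ?case using rest insert.prems(3) by auto
qed simp

text \<open>An upper triangular substitution sends a variable to a combination of itself and larger
  variables. Since the order is compatible with products, terms can only grow.\<close>

lemma coef_upper_triangular:
  assumes "\<And>i j. i < j \<Longrightarrow> j \<le> n \<Longrightarrow> lt (xterm i) (xterm j)"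
    and "u \<in> carrier_mat (n + 1) (n + 1)" "upper_triangular u" "t \<in> T" "coef u t s \<noteq> 0"
  shows "s = t \<or> lt t s"
proof -
  let ?R = "\<lambda>a b. a \<in> terms_S n \<and> b \<in> terms_S n \<and> (b = a \<or> lt a b)"
  have "?R t s"
  proof (rule pmon_keys[where R = ?R and V = "{..n}" and s = "lin_form u"])
    fix a b a' b' assume R: "?R a b" "?R a' b'"
    \<comment> \<open>The two factors are compared one at a time, with \<open>b + a'\<close> in
      between.\<close>
    have "a + a' = b + a' \<or> lt (a + a') (b + a')"
      using R lt_add by blast
    moreover have "b + a' = b + b' \<or> lt (b + a') (b + b')"
      using R lt_add[of a' b' b] by (auto simp: add.commute[of b])
    ultimately have "b + b' = a + a' \<or> lt (a + a') (b + b')"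
      using lt_trans[of "a + a'" "b + a'" "b + b'"] R terms_S_add[of a a'] terms_S_add[of b a']
        terms_S_add[of b b'] by auto
    then show "?R (a + a') (b + b')" using R terms_S_add by simp
  next
    fix v b assume v: "v \<in> {..n}" and "b \<in> Poly_Mapping.keys (lin_form u v)"
    then obtain j where j: "j \<le> n" "b = xterm j" "u $$ (v, j) \<noteq> 0"
      by (elim keys_lin_form)
    have "\<not> j < v" using j assms(2,3) v by (auto simp: upper_triangular_def)
    then have "j = v \<or> lt (xterm v) (xterm j)" using assms(1)[of v j] j by linarith
    then show "?R (Poly_Mapping.single v 1) b"
      using xterm_terms_S[of v] xterm_terms_S[of j] v j by (auto simp: xterm_def)
  next
    show "Poly_Mapping.keys t \<subseteq> {..n}" using assms(4) by (simp add: terms_deg_def terms_S_def)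
    show "s \<in> Poly_Mapping.keys (pmon (lin_form u) t)" using assms(5) by (simp add: coef_def in_keys_iff)
  qed simp
  then show ?thesis by simp
qed

text \<open>A nonzero minor has a nonzero Leibniz summand, hence a permutation \<open>p\<close> with
  each \<open>L ! i\<close> at most \<open>M ! p i\<close>. If \<open>M ! j\<close> were below
  \<open>L ! j\<close>, then \<open>p\<close> would map the \<open>j + 1\<close> indices up to
  \<open>j\<close> injectively into the \<open>j\<close> indices below \<open>j\<close>.\<close>

lemma minor_upper_triangular:
  fixes u :: "'k::field mat"
  assumes "\<And>i j. i < j \<Longrightarrow> j \<le> n \<Longrightarrow> lt (xterm i) (xterm j)"
    and "u \<in> carrier_mat (n + 1) (n + 1)" "upper_triangular u" "L \<in> E" "M \<in> E"
    and "minor (coef u) L M \<noteq> 0"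
  shows "\<not> ext_less lt M L"
proof
  assume "ext_less lt M L"
  then obtain j where j: "j < q" "lt (M ! j) (L ! j)"
    using E_D(1) assms(4,5) by (auto simp: ext_less_def)
  have "minor (coef u) L M =
      (\<Sum>p | p permutes {0..<q}. of_int (sign p) * (\<Prod>i = 0..<q. coef u (L ! i) (M ! p i)))"
    unfolding minor_def
    by (subst det_def'[of _ q]) (auto simp: permutes_in_image intro!: sum.cong prod.cong)
  then have "(\<Sum>p | p permutes {0..<q}. of_int (sign p) * (\<Prod>i = 0..<q. coef u (L ! i) (M ! p i))) \<noteq> 0"
    using assms(6) by simp
  then obtain p where p': "p \<in> {p. p permutes {0..<q}}"
    and "of_int (sign p) * (\<Prod>i = 0..<q. coef u (L ! i) (M ! p i)) \<noteq> 0"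
    by (rule sum.not_neutral_contains_not_neutral)
  from p' have p: "p permutes {0..<q}" by simp
  have nz: "coef u (L ! i) (M ! p i) \<noteq> 0" if "i < q" for i
    using that \<open>of_int (sign p) * (\<Prod>i = 0..<q. coef u (L ! i) (M ! p i)) \<noteq> 0\<close> by auto
  \<comment> \<open>Otherwise \<open>M ! p i\<close> is at most \<open>M ! j\<close>, which is below
    \<open>L ! j\<close>, which is at most \<open>L ! i\<close>, which is at most
    \<open>M ! p i\<close>.\<close>
  have "p i < j" if "i \<le> j" for i
  proof (rule ccontr)
    assume pi: "\<not> p i < j"
    have i: "i < q" "p i < q" using that j permutes_in_image[OF p, of i] by auto
    have "M ! p i = M ! j \<or> lt (M ! p i) (M ! j)"
      using E_D(3)[OF assms(5), of j "p i"] pi i by (cases "p i = j") auto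
    moreover have "L ! i = L ! j \<or> lt (L ! j) (L ! i)"
      using E_D(3)[OF assms(4), of i j] that j by (cases "i = j") auto
    moreover have "M ! p i = L ! i \<or> lt (L ! i) (M ! p i)"
      using coef_upper_triangular[OF assms(1-3) E_D(4)[OF assms(4) i(1)] nz[OF i(1)]] by blast
    ultimately show False
      using j(2) lt_trans[of "M ! p i" "M ! j" "L ! j"] lt_trans[of "M ! p i" "L ! j" "L ! i"]
        lt_trans[of "L ! i" "M ! p i" "L ! i"] lt_irrefl[of "L ! i"]
        E_D(5)[OF assms(4) i(1)] E_D(5)[OF assms(4) j(1)] E_D(5)[OF assms(5) i(2)] E_D(5)[OF assms(5) j(1)]
      by auto
  qed
  then have "p ` {..j} \<subseteq> {..<j}" by auto
  moreover have "inj_on p {..j}" using permutes_inj[OF p] by (rule inj_on_subset) simp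
  ultimately have "card {..j} \<le> card {..<j}"
    by (intro card_inj_on_le) auto
  then show False by simp
qed

text \<open>The set \<open>W\<close> is traded for a single point \<open>Q\<close> of its orbit.
  Translates of \<open>Q\<close> stay in that orbit, so the maximality of \<open>gin\<close> bounds
  the nonvanishing coordinates of all of them.\<close>

lemma gin_max:
  fixes W :: "'k::field plpoly set set"
  assumes "q > 0" "W \<subseteq> Gr" "W \<noteq> {}"
  obtains Q :: "'k::field plpoly set" where "Q \<in> Gr" "gin n m q lt W \<in> E" "pvar (gin n m q lt W) \<notin> Q"
    "\<And>g M. g \<in> GL_mat n \<Longrightarrow> M \<in> E \<Longrightarrow> pvar M \<notin> act g Q \<Longrightarrow>
      M = gin n m q lt W \<or> ext_less lt M (gin n m q lt W)"
proof -
  define A where "A = {L \<in> E. Gr_chart n m q lt L \<inter> orbit_Gr n m q lt W \<noteq> {}}"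
  have A_iff: "L \<in> A \<longleftrightarrow> L \<in> E \<and> (\<exists>V\<in>W. \<exists>g\<in>GL_mat n. pvar L \<notin> act g V)" for L
    using act_Gr_points[OF assms(1)] assms(2)
    unfolding A_def Gr_chart_def orbit_Gr_def by blast
  \<comment> \<open>The maximum is taken over a nonempty set: the translate of \<open>V0\<close> by
    the identity is a point, and a point has a nonvanishing coordinate.\<close>
  obtain V0 where "V0 \<in> W" using assms(3) by blast
  then have "act (1\<^sub>m (n + 1)) V0 \<in> Gr"
    using assms(2) GL_one by (intro act_Gr_points[OF assms(1)]) auto
  then obtain L0 where "L0 \<in> E" "pvar L0 \<notin> act (1\<^sub>m (n + 1)) V0"
    by (auto simp: Gr_points_def)
  then have "L0 \<in> A"
    unfolding A_iff using \<open>V0 \<in> W\<close> GL_one by blast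
  moreover have A: "A \<subseteq> E" by (auto simp: A_def)
  ultimately obtain L where L: "L \<in> A" "\<And>M. M \<in> A \<Longrightarrow> M = L \<or> ext_less lt M L"
    using E_max_exists[OF A] by blast
  have gin: "gin n m q lt W = L"
    using E_max_unique[OF A L] by (simp add: gin_def A_def)
  obtain V h where V: "V \<in> W" "h \<in> GL_mat n" "pvar L \<notin> act h V"
    using L(1) by (auto simp: A_iff)
  show ?thesis
  proof (rule that[of "act h V"])
    show "act h V \<in> Gr" using act_Gr_points[OF assms(1)] assms(2) V by blast
    fix g M assume g: "g \<in> GL_mat n" "M \<in> E" "pvar M \<notin> act g (act h V)"
    then have "M \<in> A"
      using V GL_mult[OF V(2) g(1)] by (auto simp: A_iff act_act)
    then show "M = gin n m q lt W \<or> ext_less lt M (gin n m q lt W)"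
      using L gin by simp
  qed (use L(1) V(3) gin A_iff in auto)
qed

lemma gin_borel:
  fixes W :: "'k::field plpoly set set"
  assumes "infinite (UNIV :: 'k set)" "q > 0" "W \<subseteq> Gr" "W \<noteq> {}"
    and x: "\<And>i j. i < j \<Longrightarrow> j \<le> n \<Longrightarrow> lt (xterm i) (xterm j)"
  shows "gin n m q lt W \<in> borel_ext_terms TYPE('k) n m q lt"
proof -
  define L where "L = gin n m q lt W"
  define wt where "wt M = (\<Sum>t\<in>set M. t)" for M :: "trm list"
  obtain Q :: "'k plpoly set" where Q: "Q \<in> Gr" and L: "L \<in> E" "pvar L \<notin> Q"
    and max: "\<And>g M. g \<in> GL_mat n \<Longrightarrow> M \<in> E \<Longrightarrow> pvar M \<notin> act g Q \<Longrightarrow> M = L \<or> ext_less lt M L"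
    unfolding L_def by (rule gin_max[OF assms(2-4)]) blast
  have wt: "wt M \<in> terms_S n" if "M \<in> E" for M
    unfolding wt_def using E_D(2)[OF that] T_subset by (intro terms_S_sum) blast
  \<comment> \<open>All other nonvanishing coordinates have strictly smaller weight, so
    \<open>L\<close> is alone in its weight space modulo \<open>Q\<close>.\<close>
  have only: "pvar M \<in> Q" if "M \<in> E" "wt M = wt L" "M \<noteq> L" for M
  proof (rule ccontr)
    assume "pvar M \<notin> Q"
    have "N = L \<or> ext_less lt N L" if "N \<in> E" "pvar N \<notin> Q" for N
      using max[OF GL_one that(1)] that by (simp only: pvar_act pullback_one) simp
    then have "lt (wt M) (wt L)"
      unfolding wt_def using weight_below_initial[OF Q assms(2) L] that(1,3) \<open>pvar M \<notin> Q\<close> by blast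
    then show False using lt_irrefl[OF wt[OF L(1)]] that(2) by simp
  qed
  have minor_zero: "minor (coef u) L M = 0"
    if u: "u \<in> GL_mat n" "upper_triangular u" and M: "M \<in> E" "M \<noteq> L" for u :: "'k mat" and M
  proof (rule ccontr)
    assume nz: "minor (coef u) L M \<noteq> 0"
    \<comment> \<open>Triangularity leaves only the terms \<open>M\<close> above \<open>L\<close>,
      for which maximality makes the coordinate vanish on every translate.\<close>
    have "\<not> ext_less lt M L"
      by (rule minor_upper_triangular[OF x GL_carrier[OF u(1)] u(2) L(1) M(1) nz])
    \<comment> \<open>The part of weight \<open>w\<close> of the pullback of \<open>pvar M\<close>
      by \<open>u\<close>, before the torus acts.\<close>
    define F where "F w = (\<Sum>N\<in>{N \<in> E. wt N = w}. pconst (minor (coef u) N M) * pvar N)" for w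
    have "F (wt L) \<in> Q"
    proof (rule chi_independent[OF assms(1) Q, of "wt ` E"])
      fix d :: "nat \<Rightarrow> 'k" assume d: "\<And>i. d i \<noteq> 0"
      let ?d = "mat_diag (n + 1) d"
      have D: "?d \<in> GL_mat n" by (rule GL_diag) (rule d)
      \<comment> \<open>In this order the torus acts on the point before \<open>u\<close> does. On
        coordinates \<open>u\<close> is then pulled back first, and each resulting
        \<open>pvar N\<close> is scaled by its own character.\<close>
      have "pvar M \<in> act (?d * u) Q"
        using max[OF GL_mult[OF D u(1)] M(1)] M(2) \<open>\<not> ext_less lt M L\<close> by blast
      then have "pullback ?d (pullback u (pvar M)) \<in> Q"
        using pullback_pullback_pvar[OF GL_carrier[OF u(1)] GL_carrier[OF D] M(1)]
        by (simp only: pvar_act M(1))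
      also have "pullback ?d (pullback u (pvar M)) =
          (\<Sum>N\<in>E. pconst (chi d (wt N)) * (pconst (minor (coef u) N M) * pvar N))"
        unfolding pullback_eq[of u] psubst_pvar pullback_var_minor[OF M(1)] pullback_sum pullback_mult pullback_pconst wt_def
        by (intro sum.cong refl) (simp only: pullback_diag mult.left_commute)
      also have "\<dots> = (\<Sum>w\<in>wt ` E. \<Sum>N\<in>{N \<in> E. wt N = w}.
          pconst (chi d (wt N)) * (pconst (minor (coef u) N M) * pvar N))"
        by (rule sum.image_gen[OF finite_E])
      also have "\<dots> = (\<Sum>w\<in>wt ` E. pconst (chi d w) * F w)"
        unfolding F_def sum_distrib_left by (intro sum.cong refl) auto
      finally show "(\<Sum>w\<in>wt ` E. pconst (chi d w) * F w) \<in> Q" .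
    qed (use finite_E wt L in auto)
    \<comment> \<open>Within the weight of \<open>L\<close>, everything except the summand at
      \<open>L\<close> lies in \<open>Q\<close>.\<close>
    moreover have "(\<Sum>N\<in>{N \<in> E. wt N = wt L} - {L}. pconst (minor (coef u) N M) * pvar N) \<in> Q"
      by (rule Gr_sum[OF Q], rule Gr_pconst[OF Q], rule only) simp_all
    ultimately have "F (wt L) - (\<Sum>N\<in>{N \<in> E. wt N = wt L} - {L}. pconst (minor (coef u) N M) * pvar N) \<in> Q"
      by (rule Gr_diff[OF Q])
    moreover have "F (wt L) = pconst (minor (coef u) L M) * pvar L +
        (\<Sum>N\<in>{N \<in> E. wt N = wt L} - {L}. pconst (minor (coef u) N M) * pvar N)"
      unfolding F_def by (rule sum.remove) (simp_all add: finite_E L(1))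
    ultimately have "pconst (minor (coef u) L M) * pvar L \<in> Q"
      by simp
    then have "pvar L \<in> Q"
      using nz by (rule Gr_pconst_cancel[OF Q])
    then show False using L(2) by simp
  qed
  have "act_ext n m q lt u (Poly_Mapping.single L 1) = Poly_Mapping.single L (minor (coef u) L L)"
    if "u \<in> GL_mat n" "upper_triangular u" for u :: "'k mat"
    using minor_zero[OF that] L(1)
    by (intro poly_mapping_eqI) (auto simp: lookup_act_ext lookup_single when_def)
  then show ?thesis
    unfolding borel_ext_terms_def L_def[symmetric] using L(1) by blast
qed

end

theorem corollary2p11:
  fixes n m q :: nat
    and lt :: "trm \<Rightarrow> trm \<Rightarrow> bool"
    and W :: "'k::field plpoly set set"
  assumes "infinite (UNIV :: 'k set)"
    and "m > 0"
    and "q > 0"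
    and "term_order n lt"
    and "\<And>i j. i < j \<Longrightarrow> j \<le> n \<Longrightarrow> lt (xterm i) (xterm j)"
    and "W \<subseteq> Gr_points n m q lt"
    and "W \<noteq> {}"
  shows "gin n m q lt W \<in> borel_ext_terms TYPE('k) n m q lt"
proof -
  interpret extensors n m q lt
    by unfold_locales (rule assms(4))
  show ?thesis
    by (rule gin_borel[OF assms(1,3,6,7,5)])
qed

end
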